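(* Let $\mu$ be fixed with $2\mu\notin\mathbb Z$. For any pair of values $(a_1,\sigma_1)$, $\sigma_1\in[0,1)$ (with $a_1\ne0$ complex), there exists a unique branch of the solution of $\mathrm{PVI}_\mu$ with the asymptotic behaviour $$y(x)\sim1-a_1(1-x)^{1-\sigma_1}\big(1+O((1-x)^{\varepsilon})\big)\qquad\text{as }x\to1,$$ for some $\varepsilon>0$.
   Context: $\mathrm{PVI}_\mu$ is the equation $$y''=\tfrac12\Big(\tfrac1y+\tfrac1{y-1}+\tfrac1{y-x}\Big)y'^2-\Big(\tfrac1x+\tfrac1{x-1}+\tfrac1{y-x}\Big)y'+\tfrac12\,\frac{y(y-1)(y-x)}{x^2(x-1)^2}\Big[(2\mu-1)^2+\frac{x(x-1)}{(y-x)^2}\Big].$$ A neighbourhood of $x=1$ is cut along a ray issuing from $1$ so that powers of $1-x$ are well defined; a branch is a solution on such a punctured cut neighbourhood.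
   Formalization: PVI is read with its denominators cleared; this matters only for a_1=1, sigma_1=0, where the only branch is y=x, at which the displayed equation is undefined and the claim of existence fails as literally written. *)

theory Defs
  imports "HOL-Complex_Analysis.Complex_Analysis" "HOL-Library.Landau_Symbols"
begin

definition PVI_rhs :: "complex \<Rightarrow> complex \<Rightarrow> complex \<Rightarrow> complex \<Rightarrow> complex" where
  "PVI_rhs \<mu> x y y' =
     1/2 * (1/y + 1/(y - 1) + 1/(y - x)) * y'^2
     - (1/x + 1/(x - 1) + 1/(y - x)) * y'
     + 1/2 * (y * (y - 1) * (y - x) / (x^2 * (x - 1)^2))
         * ((2*\<mu> - 1)^2 + x * (x - 1) / (y - x)^2)"

text \<open>
  The equation y'' = PVI_rhs with its denominators cleared, i.e. multiplied by
  2 x^2 (x - 1)^2 y (y - 1) (y - x). Solutions may touch the singular locus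
  y = 0, 1, x of the right-hand side, where HOL's convention 1/0 = 0 would impose a
  meaningless condition. The cleared form also admits the solution y = x, which is what
  the asymptotic data a = 1, sigma = 0 at x = 1 select.
\<close>
definition PVI_eq :: "complex \<Rightarrow> complex \<Rightarrow> complex \<Rightarrow> complex \<Rightarrow> complex \<Rightarrow> bool" where
  "PVI_eq \<mu> x y y' y'' \<longleftrightarrow>
     2 * x^2 * (x - 1)^2 * y * (y - 1) * (y - x) * y'' =
       x^2 * (x - 1)^2 * ((y - 1) * (y - x) + y * (y - x) + y * (y - 1)) * y'^2
       - 2 * x * (x - 1) * y * (y - 1)
           * ((x - 1) * (y - x) + x * (y - x) + x * (x - 1)) * y'
       + y^2 * (y - 1)^2 * ((2*\<mu> - 1)^2 * (y - x)^2 + x * (x - 1))"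

lemma PVI_eq_iff:
  assumes "x \<noteq> 0" "x \<noteq> 1" "y \<noteq> 0" "y \<noteq> 1" "y \<noteq> x"
  shows "PVI_eq \<mu> x y y' y'' \<longleftrightarrow> y'' = PVI_rhs \<mu> x y y'"
proof -
  define M where "M = 2 * x^2 * (x - 1)^2 * y * (y - 1) * (y - x)"
  have nz: "x - 1 \<noteq> 0" "y - 1 \<noteq> 0" "y - x \<noteq> 0" using assms by auto
  have M: "M \<noteq> 0" using assms nz by (simp add: M_def)
  have t1: "M * (1/2 * (1/y + 1/(y - 1) + 1/(y - x)) * y'^2) =
      x^2 * (x - 1)^2 * ((y - 1) * (y - x) + y * (y - x) + y * (y - 1)) * y'^2"
    using assms(3) nz unfolding M_def
    by (simp add: divide_simps) (simp add: algebra_simps)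
  have m: "M * (1/x + 1/(x - 1) + 1/(y - x)) =
      2 * x * (x - 1) * y * (y - 1) * ((x - 1) * (y - x) + x * (y - x) + x * (x - 1))"
    using assms(1) nz unfolding M_def
    by (simp add: divide_simps power2_eq_square) (simp add: algebra_simps)
  have t2: "M * ((1/x + 1/(x - 1) + 1/(y - x)) * y') =
      2 * x * (x - 1) * y * (y - 1) * ((x - 1) * (y - x) + x * (y - x) + x * (x - 1)) * y'"
    by (simp only: mult.assoc[symmetric] m)
  have q: "(2*\<mu> - 1)^2 + x * (x - 1) / (y - x)^2 =
      ((2*\<mu> - 1)^2 * (y - x)^2 + x * (x - 1)) / (y - x)^2"
    using nz by (simp add: add_divide_distrib)
  have t3: "M * (1/2 * (y * (y - 1) * (y - x) / (x^2 * (x - 1)^2))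
         * ((2*\<mu> - 1)^2 + x * (x - 1) / (y - x)^2)) =
      y^2 * (y - 1)^2 * ((2*\<mu> - 1)^2 * (y - x)^2 + x * (x - 1))"
  proof -
    have gen: "2 * x^2 * p^2 * y * v * d * (1/2 * (y * v * d / (x^2 * p^2)) * (K / d^2)) =
        y^2 * v^2 * K" if "p \<noteq> 0" "d \<noteq> 0" for p v d K :: complex
      using that assms(1) by (simp add: divide_simps power2_eq_square)
    show ?thesis unfolding q M_def by (rule gen[OF nz(1,3)])
  qed
  have rhs: "M * PVI_rhs \<mu> x y y' =
       x^2 * (x - 1)^2 * ((y - 1) * (y - x) + y * (y - x) + y * (y - 1)) * y'^2
       - 2 * x * (x - 1) * y * (y - 1)
           * ((x - 1) * (y - x) + x * (y - x) + x * (x - 1)) * y'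
       + y^2 * (y - 1)^2 * ((2*\<mu> - 1)^2 * (y - x)^2 + x * (x - 1))"
  proof -
    have "M * (A - B + C) = M * A - M * B + M * C" for A B C by (simp add: algebra_simps)
    then show ?thesis unfolding PVI_rhs_def by (simp only: t1 t2 t3)
  qed
  have "PVI_eq \<mu> x y y' y'' \<longleftrightarrow> M * y'' = M * PVI_rhs \<mu> x y y'"
    unfolding rhs unfolding PVI_eq_def M_def ..
  with M show ?thesis by simp
qed

definition cut_disc :: "real \<Rightarrow> real \<Rightarrow> complex set" where
  "cut_disc \<phi> r = ball 1 r - {1 + of_real t * cis \<phi> | t. t \<ge> 0}"

text \<open>
  The power (1 - x)^s on a disc cut in the direction phi: the argument of 1 - x lies in
  (phi - pi, phi + pi). Replacing phi by phi + 2 pi keeps the cut and changes the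
  branch of the power, so all branches are covered; phi = 0 is the principal one.
\<close>
definition cut_power :: "real \<Rightarrow> complex \<Rightarrow> real \<Rightarrow> complex" where
  "cut_power \<phi> x s = exp (of_real s * (Ln ((1 - x) * cis (- \<phi>)) + \<i> * of_real \<phi>))"

definition PVI_branch :: "complex \<Rightarrow> real \<Rightarrow> real \<Rightarrow> (complex \<Rightarrow> complex) \<Rightarrow> bool" where
  "PVI_branch \<mu> \<phi> r y \<longleftrightarrow>
     0 < r \<and> r \<le> 1 \<and> y holomorphic_on cut_disc \<phi> r \<and>
     (\<forall>x\<in>cut_disc \<phi> r. PVI_eq \<mu> x (y x) (deriv y x) (deriv (deriv y) x))"

definition asymp_at_1 :: "complex \<Rightarrow> real \<Rightarrow> real \<Rightarrow> real \<Rightarrow> (complex \<Rightarrow> complex) \<Rightarrow> bool" where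
  "asymp_at_1 a \<sigma> \<phi> r y \<longleftrightarrow>
     (\<exists>\<epsilon>>0. \<exists>h. h \<in> O[at 1 within cut_disc \<phi> r](\<lambda>x. cut_power \<phi> x \<epsilon>) \<and>
        (\<forall>x\<in>cut_disc \<phi> r. y x = 1 - a * cut_power \<phi> x (1 - \<sigma>) * (1 + h x)))"

end

theory Submission
  imports Defs
begin

text \<open>
  Put \<open>s = log (1 - x)\<close>, which maps the cut disc to a half-strip extending to \<open>Re s = -\<infinity>\<close>, and
  \<open>1 - y = a exp ((1 - \<sigma>) s + v)\<close>. The equation becomes \<open>v'' = F(s, v, v')\<close>, where \<open>F\<close> is
  exponentially small for small \<open>v\<close> and \<open>v'\<close>, because the leading part of PVI at \<open>x = 1\<close> is
  \<open>(log (1 - y))'' = 0\<close>. Integrating from \<open>-\<infinity>\<close> gives a contraction, hence a decaying solution \<open>v\<close>.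
  The asymptotic condition makes \<open>v\<close> decay exponentially, Cauchy's estimate makes \<open>v'\<close> decay too,
  and two decaying solutions agree near \<open>-\<infinity>\<close> on the axis of the strip.

  Only for \<open>\<sigma> = 0\<close>, \<open>a = 1\<close> does \<open>y - x\<close> vanish to leading order and \<open>F\<close> become singular. Then
  \<open>y = x\<close> is a solution, and uniqueness follows from a regular linear system for \<open>v\<close>, \<open>v'\<close> and
  the energy \<open>v'\<^sup>2 / (exp v - 1)\<close>.
\<close>

section \<open>Exponentially decaying functions on half-strips\<close>

text \<open>In the variable \<open>s\<close> powers of \<open>1 - x\<close> become exponentials and
  the domain becomes convex, so primitives exist and one of them can be normalised at
  \<open>Re s = -\<infinity>\<close>. The contraction lives on surplus decay: solutions are sought
  at rate \<open>\<epsilon>\<close>, while the right-hand side decays at rate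
  \<open>2 * \<epsilon>\<close>, and moving the half-strip to the left turns the surplus into a
  small constant. Cauchy estimates cost strip width, so uniqueness is proved on one horizontal line
  only and the identity theorem recovers the full domain.

  In the degenerate case no Lipschitz bound is available: to lowest order the equation is
  \<open>2 v v'' = v'^2\<close>, which besides \<open>v = 0\<close> has the solutions
  \<open>c (s - s0)^2\<close> through zeros of \<open>v\<close>. On them the energy is the constant
  \<open>4 c\<close>. Hence the energy is carried as a third unknown: its decay excludes these
  solutions, and the enlarged system has no singularity left.\<close>

lemma norm_diff_le_exp_diff:
  fixes f :: "real \<Rightarrow> complex"
  assumes der: "\<And>x. x < L \<Longrightarrow> (f has_vector_derivative f' x) (at x)"
    and bd: "\<And>x. x < L \<Longrightarrow> norm (f' x) \<le> K * exp (c * x)"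
    and "c > 0" "y \<le> x" "x < L"
  shows "norm (f x - f y) \<le> K / c * (exp (c * x) - exp (c * y))"
proof (cases "y = x")
  case False
  with assms have "y < x" by simp
  then have "norm (f x - f y) \<le> K / c * exp (c * x) - K / c * exp (c * y)"
  proof (rule differentiable_bound_general)
    show "continuous_on {y..x} f"
      using der \<open>x < L\<close>
      by (intro continuous_at_imp_continuous_on ballI) (meson atLeastAtMost_iff has_vector_derivative_continuous le_less_trans)
    show "continuous_on {y..x} (\<lambda>x. K / c * exp (c * x))"
      by (intro continuous_intros)
    fix z assume z: "y < z" "z < x"
    show "(f has_vector_derivative f' z) (at z)" "norm (f' z) \<le> K * exp (c * z)"
      using der bd z \<open>x < L\<close> by auto
    show "((\<lambda>x. K / c * exp (c * x)) has_vector_derivative K * exp (c * z)) (at z)"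
      unfolding has_real_derivative_iff_has_vector_derivative[symmetric]
      using \<open>c > 0\<close> by (auto intro!: derivative_eq_intros)
  qed
  then show ?thesis by (simp add: right_diff_distrib)
qed simp

lemma tendsto_exp_mult_at_bot:
  fixes c :: real
  assumes "c > 0"
  shows "((\<lambda>x. exp (c * x)) \<longlongrightarrow> 0) at_bot"
  using assms by real_asymp

text \<open>Let \<open>y\<close> tend to \<open>-\<infinity>\<close> in the preceding bound: the
  limit 0 removes the constant of integration, and one integration costs the factor
  \<open>1 / c\<close>.\<close>

lemma decay_from_derivative_bound:
  fixes f :: "real \<Rightarrow> complex"
  assumes der: "\<And>x. x < L \<Longrightarrow> (f has_vector_derivative f' x) (at x)"
    and bd: "\<And>x. x < L \<Longrightarrow> norm (f' x) \<le> K * exp (c * x)"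
    and "c > 0" and lim: "(f \<longlongrightarrow> 0) at_bot" and "x < L"
  shows "norm (f x) \<le> K / c * exp (c * x)"
proof -
  have "((\<lambda>y. norm (f x - f y)) \<longlongrightarrow> norm (f x - 0)) at_bot"
    by (intro tendsto_intros lim)
  moreover have "((\<lambda>y. K / c * (exp (c * x) - exp (c * y))) \<longlongrightarrow> K / c * (exp (c * x) - 0)) at_bot"
    by (intro tendsto_intros tendsto_exp_mult_at_bot \<open>c > 0\<close>)
  moreover have "eventually (\<lambda>y. norm (f x - f y) \<le> K / c * (exp (c * x) - exp (c * y))) at_bot"
    using eventually_le_at_bot[of x]
    by eventually_elim (rule norm_diff_le_exp_diff[OF der bd \<open>c > 0\<close> _ \<open>x < L\<close>])
  ultimately have "norm (f x - 0) \<le> K / c * (exp (c * x) - 0)"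
    by (intro tendsto_le[OF trivial_limit_at_bot_linorder])
  then show ?thesis by simp
qed

lemma tendsto_0_of_exp_bound:
  fixes f :: "real \<Rightarrow> complex"
  assumes "\<And>x. x < L \<Longrightarrow> norm (f x) \<le> B * exp (c * x)" "c > 0"
  shows "(f \<longlongrightarrow> 0) at_bot"
proof (rule Lim_null_comparison)
  show "eventually (\<lambda>x. norm (f x) \<le> B * exp (c * x)) at_bot"
    using eventually_gt_at_bot[of L] assms(1) by (auto simp: eventually_at_bot_dense)
  show "((\<lambda>x. B * exp (c * x)) \<longlongrightarrow> 0) at_bot"
    using tendsto_mult_right_zero[OF tendsto_exp_mult_at_bot[OF \<open>c > 0\<close>]] by blast
qed

lemma eventually_exp_le:
  fixes c d K :: real
  assumes "c > 0" "d > 0"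
  shows "eventually (\<lambda>x. K * exp (c * x) \<le> d) at_bot"
proof -
  have "((\<lambda>x. K * exp (c * x)) \<longlongrightarrow> 0) at_bot"
    using tendsto_mult_right_zero[OF tendsto_exp_mult_at_bot[OF \<open>c > 0\<close>]] by blast
  then have "eventually (\<lambda>x. K * exp (c * x) < d) at_bot"
    using assms(2) by (rule order_tendstoD)
  then show ?thesis by eventually_elim simp
qed

text \<open>
  The decay rate of the coefficients gains a factor exp (eps x) in each integration, so every
  exponential bound with constant B on a fixed half-line improves to one with constant B/2.
\<close>
lemma decaying_system_trivial:
  fixes f g k f' g' k' :: "real \<Rightarrow> complex"
  assumes df: "\<And>x. x < L \<Longrightarrow> (f has_vector_derivative f' x) (at x)"
    and dg: "\<And>x. x < L \<Longrightarrow> (g has_vector_derivative g' x) (at x)"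
    and dk: "\<And>x. x < L \<Longrightarrow> (k has_vector_derivative k' x) (at x)"
    and bf: "\<And>x. x < L \<Longrightarrow> norm (f' x) \<le> A * norm (g x)"
    and bg: "\<And>x. x < L \<Longrightarrow> norm (g' x) \<le> A * norm (k x) + A * exp (e * x) * (norm (f x) + norm (g x))"
    and bk: "\<And>x. x < L \<Longrightarrow> norm (k' x) \<le> A * exp (e * x) * (norm (f x) + norm (g x) + norm (k x))"
    and decay: "\<And>x. x < L \<Longrightarrow> norm (f x) \<le> B * exp (e * x)"
      "\<And>x. x < L \<Longrightarrow> norm (g x) \<le> B * exp (e * x)"
      "\<And>x. x < L \<Longrightarrow> norm (k x) \<le> B * exp (e * x)"
    and "e > 0" "A \<ge> 0"
  obtains M where "M \<le> L" "\<And>x. x < M \<Longrightarrow> f x = 0"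
proof -
  \<comment> \<open>Bounds for \<open>k\<close>, \<open>g\<close>, \<open>f\<close> after one
    integration at rate \<open>2 * e\<close>, per unit of the old constant. The order is forced:
    \<open>g'\<close> contains \<open>k\<close>, and \<open>f'\<close> contains \<open>g\<close>,
    without a decaying factor, so each needs the improved bound of its predecessor. The half-line
    \<open>M\<close> chosen from them does not depend on the old constant, so the halving can be
    repeated.\<close>
  define P where "P = A * 3 / (2 * e)"
  define Q where "Q = (A * P + 2 * A) / (2 * e)"
  define R where "R = A * Q / (2 * e)"
  have nn: "P \<ge> 0" "Q \<ge> 0" "R \<ge> 0"
    using \<open>e > 0\<close> \<open>A \<ge> 0\<close> by (auto simp: P_def Q_def R_def)
  have "eventually (\<lambda>x. (P + Q + R) * exp (e * x) \<le> 1/2) at_bot"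
    using \<open>e > 0\<close> by (intro eventually_exp_le) auto
  then obtain M0 where M0: "\<And>x. x \<le> M0 \<Longrightarrow> (P + Q + R) * exp (e * x) \<le> 1/2"
    by (auto simp: eventually_at_bot_linorder)
  define M where "M = min L M0"
  have lims: "(f \<longlongrightarrow> 0) at_bot" "(g \<longlongrightarrow> 0) at_bot" "(k \<longlongrightarrow> 0) at_bot"
    by (rule tendsto_0_of_exp_bound[OF decay(1) \<open>e > 0\<close>], simp)
       (rule tendsto_0_of_exp_bound[OF decay(2) \<open>e > 0\<close>], simp,
        rule tendsto_0_of_exp_bound[OF decay(3) \<open>e > 0\<close>], simp)
  have half: "(\<forall>x<M. norm (f x) \<le> b/2 * exp (e * x)) \<and> (\<forall>x<M. norm (g x) \<le> b/2 * exp (e * x)) \<and>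
      (\<forall>x<M. norm (k x) \<le> b/2 * exp (e * x))"
    if "b \<ge> 0" and f: "\<And>x. x < M \<Longrightarrow> norm (f x) \<le> b * exp (e * x)"
      and g: "\<And>x. x < M \<Longrightarrow> norm (g x) \<le> b * exp (e * x)"
      and k: "\<And>x. x < M \<Longrightarrow> norm (k x) \<le> b * exp (e * x)" for b
  proof -
    have e2: "exp (2 * e * x) = exp (e * x) * exp (e * x)" for x
      by (simp flip: exp_add)
    have d2: "2 * e > 0" using \<open>e > 0\<close> by simp
    have gain: "c * b * exp (2 * e * x) \<le> b/2 * exp (e * x)" if "x < M" "c \<le> P + Q + R" for c x
    proof -
      have "c * exp (e * x) \<le> (P + Q + R) * exp (e * x)"
        using that by (intro mult_right_mono) auto
      also have "\<dots> \<le> 1/2" using M0[of x] that by (simp add: M_def)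
      finally have "(c * exp (e * x)) * (b * exp (e * x)) \<le> 1/2 * (b * exp (e * x))"
        using \<open>b \<ge> 0\<close> by (intro mult_right_mono) auto
      then show ?thesis unfolding e2 by (simp add: mult_ac)
    qed
    have k2: "norm (k x) \<le> P * b * exp (2 * e * x)" if "x < M" for x
    proof -
      have "norm (k' z) \<le> (A * 3 * b) * exp (2 * e * z)" if "z < M" for z
      proof -
        have "norm (k' z) \<le> A * exp (e * z) * (norm (f z) + norm (g z) + norm (k z))"
          using that by (intro bk) (simp add: M_def)
        also have "\<dots> \<le> A * exp (e * z) * (b * exp (e * z) + b * exp (e * z) + b * exp (e * z))"
          using that \<open>A \<ge> 0\<close> by (intro mult_left_mono add_mono f g k) auto
        finally show ?thesis unfolding e2 by (simp add: algebra_simps)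
      qed
      from decay_from_derivative_bound[OF dk this d2 lims(3) that] show ?thesis
        by (simp add: P_def M_def)
    qed
    have g2: "norm (g x) \<le> Q * b * exp (2 * e * x)" if "x < M" for x
    proof -
      have "norm (g' z) \<le> ((A * P + 2 * A) * b) * exp (2 * e * z)" if "z < M" for z
      proof -
        have "norm (g' z) \<le> A * norm (k z) + A * exp (e * z) * (norm (f z) + norm (g z))"
          using that by (intro bg) (simp add: M_def)
        also have "\<dots> \<le> A * (P * b * exp (2 * e * z)) + A * exp (e * z) * (b * exp (e * z) + b * exp (e * z))"
          using that \<open>A \<ge> 0\<close> by (intro mult_left_mono add_mono f g k2) auto
        finally show ?thesis unfolding e2 by (simp add: algebra_simps)
      qed
      from decay_from_derivative_bound[OF dg this d2 lims(2) that] show ?thesis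
        by (simp add: Q_def M_def)
    qed
    have f2: "norm (f x) \<le> R * b * exp (2 * e * x)" if "x < M" for x
    proof -
      have "norm (f' z) \<le> (A * Q * b) * exp (2 * e * z)" if "z < M" for z
      proof -
        have "norm (f' z) \<le> A * norm (g z)"
          using that by (intro bf) (simp add: M_def)
        also have "\<dots> \<le> A * (Q * b * exp (2 * e * z))"
          using that \<open>A \<ge> 0\<close> by (intro mult_left_mono g2) auto
        finally show ?thesis by (simp add: mult_ac)
      qed
      from decay_from_derivative_bound[OF df this d2 lims(1) that] show ?thesis
        by (simp add: R_def M_def)
    qed
    show ?thesis
      using order_trans[OF f2 gain] order_trans[OF g2 gain] order_trans[OF k2 gain] nn
      by auto
  qed
  have B: "B \<ge> 0"
    using order_trans[OF norm_ge_zero decay(1)[of "L - 1"]] by (simp add: zero_le_mult_iff)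
  have iter: "(\<forall>x<M. norm (f x) \<le> B / 2 ^ n * exp (e * x)) \<and> (\<forall>x<M. norm (g x) \<le> B / 2 ^ n * exp (e * x)) \<and>
      (\<forall>x<M. norm (k x) \<le> B / 2 ^ n * exp (e * x))" for n
  proof (induction n)
    case 0
    then show ?case using decay by (auto simp: M_def)
  next
    case (Suc n)
    then show ?case using half[of "B / 2 ^ n"] B by (auto simp: field_simps)
  qed
  have "f x = 0" if "x < M" for x
  proof -
    have "(\<lambda>n. B / 2 ^ n * exp (e * x)) \<longlonglongrightarrow> 0"
      by real_asymp
    then have "norm (f x) \<le> 0"
      using iter that by (intro LIMSEQ_le_const) auto
    then show ?thesis by simp
  qed
  then show thesis by (intro that[of M]) (auto simp: M_def)
qed

section \<open>Half-strips: Cauchy estimates and decaying primitives\<close>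

text \<open>For \<open>b = pi\<close> and \<open>L = ln r\<close> this is the image of the cut disc
  under \<open>s = log (1 - x)\<close>. The half-width is kept free because Cauchy estimates shrink
  it.\<close>

definition half_strip :: "real \<Rightarrow> real \<Rightarrow> real \<Rightarrow> complex set" where
  "half_strip \<phi> b L = {s. Re s < L \<and> \<bar>Im s - \<phi>\<bar> < b}"

lemma half_strip_eq_vimage:
  "half_strip \<phi> b L = {s. Re s < L} \<inter> {s. Im s < \<phi> + b} \<inter> {s. Im s > \<phi> - b}"
  by (auto simp: half_strip_def)

lemma open_half_strip [intro, simp]: "open (half_strip \<phi> b L)"
  unfolding half_strip_eq_vimage
  by (intro open_Int open_halfspace_Re_lt open_halfspace_Im_lt open_halfspace_Im_gt)

lemma convex_half_strip [intro, simp]: "convex (half_strip \<phi> b L)"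
  unfolding half_strip_eq_vimage
  by (intro convex_Int convex_halfspace_Re_lt convex_halfspace_Im_lt convex_halfspace_Im_gt)

lemma half_strip_mono: "b \<le> b' \<Longrightarrow> L \<le> L' \<Longrightarrow> half_strip \<phi> b L \<subseteq> half_strip \<phi> b' L'"
  by (auto simp: half_strip_def)

lemma has_vector_derivative_horizontal:
  assumes "(f has_field_derivative f') (at (Complex x y))"
  shows "((\<lambda>x. f (Complex x y)) has_vector_derivative f') (at x)"
proof -
  have "((\<lambda>x. Complex x y) has_vector_derivative 1) (at x)"
    unfolding Complex_eq by (auto intro!: derivative_eq_intros)
  from field_vector_diff_chain_at[OF this assms] show ?thesis by (simp add: o_def)
qed

lemma norm_deriv_le_of_cball:
  assumes "f holomorphic_on S" "open S" "cball z r \<subseteq> S" "r > 0"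
    and "\<And>w. w \<in> cball z r \<Longrightarrow> norm (f w) \<le> B"
  shows "norm (deriv f z) \<le> B / r"
proof -
  have "norm ((deriv ^^ 1) f z) \<le> fact 1 * B / r ^ 1"
    using assms
    by (intro Cauchy_inequality holomorphic_on_subset[OF assms(1)] holomorphic_on_imp_continuous_on)
       (auto simp: dist_norm)
  then show ?thesis by simp
qed

text \<open>Cauchy's estimate on the unit disc around \<open>s\<close>, which stays in the larger
  strip and on which the majorant grows by at most the factor \<open>exp c\<close>.\<close>

lemma deriv_bound_half_strip:
  assumes "f holomorphic_on half_strip \<phi> b L" "B \<ge> 0" "c \<ge> 0"
    and bd: "\<And>s. s \<in> half_strip \<phi> b L \<Longrightarrow> norm (f s) \<le> B * exp (c * Re s)"
    and s: "s \<in> half_strip \<phi> (b - 1) (L - 1)"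
  shows "norm (deriv f s) \<le> B * exp c * exp (c * Re s)"
proof -
  have sub: "cball s 1 \<subseteq> half_strip \<phi> b L"
  proof
    fix w assume "w \<in> cball s 1"
    then have "norm (w - s) \<le> 1" by (simp add: dist_norm norm_minus_commute)
    then have "\<bar>Re w - Re s\<bar> \<le> 1" "\<bar>Im w - Im s\<bar> \<le> 1"
      using abs_Re_le_cmod[of "w - s"] abs_Im_le_cmod[of "w - s"] by auto
    then show "w \<in> half_strip \<phi> b L" using s by (auto simp: half_strip_def)
  qed
  have "norm (deriv f s) \<le> (B * exp c * exp (c * Re s)) / 1"
  proof (rule norm_deriv_le_of_cball[OF assms(1) open_half_strip sub])
    fix w assume w: "w \<in> cball s 1"
    then have "Re w \<le> Re s + 1"
      using abs_Re_le_cmod[of "w - s"] by (simp add: dist_norm norm_minus_commute)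
    then have "c * Re w \<le> c + c * Re s"
      using mult_left_mono[of "Re w" "Re s + 1" c] \<open>c \<ge> 0\<close> by (simp add: algebra_simps)
    then have "B * exp (c * Re w) \<le> B * exp (c + c * Re s)"
      using \<open>B \<ge> 0\<close> by (intro mult_left_mono) auto
    with bd[of w] w sub show "norm (f w) \<le> B * exp c * exp (c * Re s)"
      by (auto simp: exp_add)
  qed simp
  then show ?thesis by simp
qed

text \<open>Closed discs of radius \<open>\<rho>\<close> around points of
  \<open>cball 0 \<rho>\<close> lie in the open ball of radius \<open>3 * \<rho>\<close>, so Cauchy
  bounds the derivative by \<open>B / \<rho>\<close>. This later gives Lipschitz constants from size
  bounds alone.\<close>

lemma holomorphic_lipschitz_ball:
  assumes hol: "f holomorphic_on ball 0 (3 * \<rho>)" and "\<rho> > 0"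
    and bd: "\<And>z. z \<in> ball 0 (3 * \<rho>) \<Longrightarrow> norm (f z) \<le> B"
    and "norm z \<le> \<rho>" "norm w \<le> \<rho>"
  shows "norm (f z - f w) \<le> B / \<rho> * norm (z - w)"
proof (rule field_differentiable_bound[of "cball 0 \<rho>" f "deriv f"])
  fix x :: complex assume x: "x \<in> cball 0 \<rho>"
  then show "(f has_field_derivative deriv f x) (at x within cball 0 \<rho>)"
    using \<open>\<rho> > 0\<close>
    by (intro has_field_derivative_at_within[OF holomorphic_derivI[OF hol]]) auto
  have sub: "cball x \<rho> \<subseteq> ball 0 (3 * \<rho>)"
  proof
    fix w assume w: "w \<in> cball x \<rho>"
    have "norm w \<le> norm x + norm (w - x)" by (rule norm_triangle_sub)
    also have "\<dots> \<le> \<rho> + \<rho>" using w x by (intro add_mono) (auto simp: dist_norm norm_minus_commute)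
    finally show "w \<in> ball 0 (3 * \<rho>)" using \<open>\<rho> > 0\<close> by simp
  qed
  show "norm (deriv f x) \<le> B / \<rho>"
    by (rule norm_deriv_le_of_cball[OF hol open_ball sub \<open>\<rho> > 0\<close>]) (use bd sub in blast)
qed (use assms in auto)

text \<open>Integration along the horizontal line through \<open>s\<close>. The a priori decay with
  \<open>B\<close> and \<open>d\<close> only fixes the constant of integration, so neither enters
  the conclusion.\<close>

lemma half_strip_decay_from_derivative:
  assumes der: "\<And>s. s \<in> half_strip \<phi> b L \<Longrightarrow> (f has_field_derivative f' s) (at s)"
    and bd: "\<And>s. s \<in> half_strip \<phi> b L \<Longrightarrow> norm (f' s) \<le> K * exp (c * Re s)"
    and decay: "\<And>s. s \<in> half_strip \<phi> b L \<Longrightarrow> norm (f s) \<le> B * exp (d * Re s)"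
    and "c > 0" "d > 0" and s: "s \<in> half_strip \<phi> b L"
  shows "norm (f s) \<le> K / c * exp (c * Re s)"
proof -
  have mem: "Complex x (Im s) \<in> half_strip \<phi> b L" if "x < L" for x
    using that s by (auto simp: half_strip_def)
  have "norm (f (Complex (Re s) (Im s))) \<le> K / c * exp (c * Re s)"
  proof (rule decay_from_derivative_bound)
    show "((\<lambda>x. f (Complex x (Im s))) \<longlongrightarrow> 0) at_bot"
      using decay[OF mem] \<open>d > 0\<close> by (intro tendsto_0_of_exp_bound[of L _ B d]) auto
    fix x assume "x < L"
    then show "((\<lambda>x. f (Complex x (Im s))) has_vector_derivative f' (Complex x (Im s))) (at x)"
      by (intro has_vector_derivative_horizontal der mem)
    show "norm (f' (Complex x (Im s))) \<le> K * exp (c * x)"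
      using bd[OF mem[OF \<open>x < L\<close>]] by simp
  qed (use \<open>c > 0\<close> s in \<open>auto simp: half_strip_def\<close>)
  then show ?thesis by simp
qed

text \<open>Any primitive has a limit along the axis, because its derivative is integrable towards
  \<open>-\<infinity>\<close>. The limit is the same on every horizontal line: crossing the strip at
  \<open>Re s = - n\<close> changes the primitive by at most \<open>K * exp (- c * n) * b\<close>.
  Subtracting the limit gives the decaying primitive.\<close>

lemma half_strip_decaying_primitive:
  assumes hol: "g holomorphic_on half_strip \<phi> b L"
    and bd: "\<And>s. s \<in> half_strip \<phi> b L \<Longrightarrow> norm (g s) \<le> K * exp (c * Re s)"
    and "c > 0" "b > 0"
  obtains G where "\<And>s. s \<in> half_strip \<phi> b L \<Longrightarrow> (G has_field_derivative g s) (at s)"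
    and "\<And>s. s \<in> half_strip \<phi> b L \<Longrightarrow> norm (G s) \<le> K / c * exp (c * Re s)"
proof -
  let ?S = "half_strip \<phi> b L"
  obtain G0 where G0: "\<And>x. x \<in> ?S \<Longrightarrow> (G0 has_field_derivative g x) (at x within ?S)"
    using holomorphic_convex_primitive'[OF convex_half_strip open_half_strip hol] by blast
  have G0': "(G0 has_field_derivative g s) (at s)" if "s \<in> ?S" for s
    using G0[OF that] at_within_open[OF that open_half_strip] by simp
  have K: "K \<ge> 0"
  proof -
    have "Complex (L - 1) \<phi> \<in> ?S" using \<open>b > 0\<close> by (simp add: half_strip_def)
    from order_trans[OF norm_ge_zero bd[OF this]] show ?thesis by (simp add: zero_le_mult_iff)
  qed
  have horiz: "norm (G0 (Complex x y) - G0 (Complex x' y)) \<le> K / c * exp (c * x)"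
    if "x' \<le> x" "x < L" "\<bar>y - \<phi>\<bar> < b" for x x' y
  proof -
    have mem: "Complex x y \<in> ?S" if "x < L" for x
      using that \<open>\<bar>y - \<phi>\<bar> < b\<close> by (auto simp: half_strip_def)
    have "norm (G0 (Complex x y) - G0 (Complex x' y)) \<le> K / c * (exp (c * x) - exp (c * x'))"
    proof (rule norm_diff_le_exp_diff)
      fix x assume "x < L"
      then show "((\<lambda>x. G0 (Complex x y)) has_vector_derivative g (Complex x y)) (at x)"
        by (intro has_vector_derivative_horizontal G0' mem)
      show "norm (g (Complex x y)) \<le> K * exp (c * x)"
        using bd[OF mem[OF \<open>x < L\<close>]] by simp
    qed (use that \<open>c > 0\<close> in auto)
    also have "\<dots> \<le> K / c * exp (c * x)"
      using K \<open>c > 0\<close> by (intro mult_left_mono) auto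
    finally show ?thesis .
  qed
  define X where "X n = G0 (Complex (- real n) \<phi>)" for n
  obtain N where N: "real N > - L" using reals_Archimedean2 by blast
  have "Cauchy X"
  proof (rule metric_CauchyI)
    fix e :: real assume "e > 0"
    have "(\<lambda>n. K / c * exp (c * - real n)) \<longlonglongrightarrow> 0" using \<open>c > 0\<close> by real_asymp
    then have "eventually (\<lambda>n. K / c * exp (c * - real n) < e) sequentially"
      using \<open>e > 0\<close> by (rule order_tendstoD)
    then obtain M where M: "\<And>n. n \<ge> M \<Longrightarrow> K / c * exp (c * - real n) < e"
      by (auto simp: eventually_sequentially)
    have *: "dist (X m) (X n) < e" if "m \<ge> max M N" "n \<ge> m" for m n
    proof -
      have "norm (X m - X n) \<le> K / c * exp (c * - real m)"
        unfolding X_def by (rule horiz) (use that N \<open>b > 0\<close> in auto)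
      with M[of m] that show ?thesis by (auto simp: dist_norm)
    qed
    show "\<exists>M. \<forall>m\<ge>M. \<forall>n\<ge>M. dist (X m) (X n) < e"
    proof (intro exI allI impI)
      fix m n assume "m \<ge> max M N" "n \<ge> max M N"
      then show "dist (X m) (X n) < e"
        using *[of m n] *[of n m] by (cases "m \<le> n") (auto simp: dist_commute)
    qed
  qed
  then obtain l where l: "X \<longlonglongrightarrow> l" using Cauchy_convergent convergent_def by blast
  have "norm (G0 s - l) \<le> K / c * exp (c * Re s)" if s: "s \<in> ?S" for s
  proof (rule tendsto_le[OF sequentially_bot])
    show "(\<lambda>n. K / c * exp (c * Re s) + K * exp (c * - real n) * b) \<longlonglongrightarrow> K / c * exp (c * Re s)"
      using \<open>c > 0\<close> by real_asymp
    show "(\<lambda>n. norm (G0 s - X n)) \<longlonglongrightarrow> norm (G0 s - l)" by (intro tendsto_intros l)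
    obtain N' where N': "real N' > - Re s" using reals_Archimedean2 by blast
    have "norm (G0 s - X n) \<le> K / c * exp (c * Re s) + K * exp (c * - real n) * b"
      if n: "n \<ge> N + N'" for n
    proof -
      let ?z = "Complex (- real n) (Im s)" and ?w = "Complex (- real n) \<phi>"
      \<comment> \<open>A convex piece of the strip containing the vertical segment from
        \<open>?z\<close> to \<open>?w\<close>, on which \<open>g\<close> is uniformly at most
        \<open>K * exp (- c * n)\<close>.\<close>
      let ?T = "?S \<inter> {s. Re s \<le> - real n}"
      have "norm (G0 (Complex (Re s) (Im s)) - G0 ?z) \<le> K / c * exp (c * Re s)"
        by (rule horiz) (use n N N' s in \<open>auto simp: half_strip_def\<close>)
      then have 1: "norm (G0 s - G0 ?z) \<le> K / c * exp (c * Re s)" by simp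
      have "norm (G0 ?z - G0 ?w) \<le> K * exp (c * - real n) * norm (?z - ?w)"
      proof (rule field_differentiable_bound[of ?T G0 g])
        show "convex ?T" by (intro convex_Int convex_half_strip convex_halfspace_Re_le)
        fix z assume z: "z \<in> ?T"
        then show "(G0 has_field_derivative g z) (at z within ?T)"
          using G0' has_field_derivative_at_within by blast
        have "norm (g z) \<le> K * exp (c * Re z)" using bd z by blast
        also have "\<dots> \<le> K * exp (c * - real n)" using z K \<open>c > 0\<close>
          by (intro mult_left_mono iffD2[OF exp_le_cancel_iff] less_imp_le[OF \<open>c > 0\<close>]) auto
        finally show "norm (g z) \<le> K * exp (c * - real n)" .
      qed (use n N N' s \<open>b > 0\<close> in \<open>auto simp: half_strip_def\<close>)
      also have "norm (?z - ?w) = \<bar>Im s - \<phi>\<bar>" by (simp add: cmod_def)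
      also have "K * exp (c * - real n) * \<bar>Im s - \<phi>\<bar> \<le> K * exp (c * - real n) * b"
        using s K by (intro mult_left_mono) (auto simp: half_strip_def)
      finally have 2: "norm (G0 ?z - X n) \<le> K * exp (c * - real n) * b" by (simp add: X_def)
      have "norm (G0 s - X n) \<le> norm (G0 s - G0 ?z) + norm (G0 ?z - X n)"
        by (rule norm_triangle_ineq4[of "G0 s - G0 ?z" "X n - G0 ?z", simplified, THEN order_trans])
           (simp add: norm_minus_commute)
      with 1 2 show ?thesis by linarith
    qed
    then show "eventually (\<lambda>n. norm (G0 s - X n) \<le> K / c * exp (c * Re s) + K * exp (c * - real n) * b) sequentially"
      unfolding eventually_sequentially by blast
  qed
  moreover have "((\<lambda>s. G0 s - l) has_field_derivative g s) (at s)" if "s \<in> ?S" for s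
    using G0'[OF that] by (auto intro!: derivative_eq_intros)
  ultimately show thesis by (intro that[of "\<lambda>s. G0 s - l"])
qed

section \<open>Second-order equations with exponentially small right-hand side\<close>

text \<open>Data for \<open>v'' = F s v v'\<close>. Both estimates are required only for arguments
  of size at most \<open>exp (\<epsilon> * Re s)\<close>, and both leave a surplus factor
  \<open>exp (\<epsilon> * Re s)\<close>, which \<open>small\<close> converts into a contraction
  factor. Holomorphy is demanded along functions within these bounds because only there do the
  denominators of the intended \<open>F\<close> stay away from 0.\<close>

locale half_strip_ode =
  fixes \<phi> b L \<epsilon> C :: real and F :: "complex \<Rightarrow> complex \<Rightarrow> complex \<Rightarrow> complex"
  assumes b: "b > 0" and eps: "0 < \<epsilon>" "\<epsilon> \<le> 1" and C: "C \<ge> 0"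
    and bound: "\<And>s v u. s \<in> half_strip \<phi> b L \<Longrightarrow> norm v \<le> exp (\<epsilon> * Re s) \<Longrightarrow> norm u \<le> exp (\<epsilon> * Re s) \<Longrightarrow>
      norm (F s v u) \<le> C * exp (2 * \<epsilon> * Re s)"
    and lipschitz: "\<And>s v u v' u'. s \<in> half_strip \<phi> b L \<Longrightarrow>
      norm v \<le> exp (\<epsilon> * Re s) \<Longrightarrow> norm u \<le> exp (\<epsilon> * Re s) \<Longrightarrow>
      norm v' \<le> exp (\<epsilon> * Re s) \<Longrightarrow> norm u' \<le> exp (\<epsilon> * Re s) \<Longrightarrow>
      norm (F s v u - F s v' u') \<le> C * exp (\<epsilon> * Re s) * (norm (v - v') + norm (u - u'))"
    and holomorphic: "\<And>v u. v holomorphic_on half_strip \<phi> b L \<Longrightarrow> u holomorphic_on half_strip \<phi> b L \<Longrightarrow>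
      (\<And>s. s \<in> half_strip \<phi> b L \<Longrightarrow> norm (v s) \<le> exp (\<epsilon> * Re s)) \<Longrightarrow>
      (\<And>s. s \<in> half_strip \<phi> b L \<Longrightarrow> norm (u s) \<le> exp (\<epsilon> * Re s)) \<Longrightarrow>
      (\<lambda>s. F s (v s) (u s)) holomorphic_on half_strip \<phi> b L"
    and small: "4 * C * exp (\<epsilon> * L) \<le> \<epsilon>\<^sup>2"
begin

abbreviation "S \<equiv> half_strip \<phi> b L"

lemma exp_eps_double: "exp (2 * \<epsilon> * x) = exp (\<epsilon> * x) * exp (\<epsilon> * x)"
  by (simp flip: exp_add)

lemma small_at:
  assumes "s \<in> S"
  shows "4 * C * exp (\<epsilon> * Re s) \<le> \<epsilon>\<^sup>2"
proof -
  have "exp (\<epsilon> * Re s) \<le> exp (\<epsilon> * L)" using assms eps by (simp add: half_strip_def)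
  then have "4 * C * exp (\<epsilon> * Re s) \<le> 4 * C * exp (\<epsilon> * L)" using C by (intro mult_left_mono) auto
  with small show ?thesis by simp
qed

text \<open>The bound \<open>\<epsilon> exp (\<epsilon> Re s)\<close> on the derivative makes the decaying primitive
  bounded by \<open>exp (\<epsilon> Re s)\<close>.\<close>
definition "good w \<longleftrightarrow> w holomorphic_on S \<and> (\<forall>s\<in>S. norm (w s) \<le> \<epsilon> * exp (\<epsilon> * Re s))"

text \<open>Decay with some constant already determines \<open>G\<close> on \<open>S\<close>.
  Leaving \<open>B\<close> existential lets every bound on \<open>g\<close> be transferred to the
  same \<open>G\<close>, whatever \<open>SOME\<close> picks, and makes the relation stable under
  differences.\<close>

definition "decaying_primitive g G \<longleftrightarrow> (\<forall>s\<in>S. (G has_field_derivative g s) (at s)) \<and>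
   (\<exists>B. \<forall>s\<in>S. norm (G s) \<le> B * exp (\<epsilon> * Re s))"

definition "prim g = (SOME G. decaying_primitive g G)"

lemma decaying_primitive_prim:
  assumes "g holomorphic_on S" "\<And>s. s \<in> S \<Longrightarrow> norm (g s) \<le> K * exp (\<epsilon> * Re s)"
  shows "decaying_primitive g (prim g)"
proof -
  obtain G where "\<And>s. s \<in> S \<Longrightarrow> (G has_field_derivative g s) (at s)"
    "\<And>s. s \<in> S \<Longrightarrow> norm (G s) \<le> K / \<epsilon> * exp (\<epsilon> * Re s)"
    using half_strip_decaying_primitive[OF assms eps(1) b] by blast
  then have "decaying_primitive g G" unfolding decaying_primitive_def by blast
  then show ?thesis unfolding prim_def by (rule someI[of "decaying_primitive g"])
qed

lemma decaying_primitive_bound: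
  assumes "decaying_primitive g G" "\<And>s. s \<in> S \<Longrightarrow> norm (g s) \<le> K * exp (c * Re s)" "c > 0" "s \<in> S"
  shows "norm (G s) \<le> K / c * exp (c * Re s)"
proof -
  obtain B where "\<And>s. s \<in> S \<Longrightarrow> (G has_field_derivative g s) (at s)"
    "\<And>s. s \<in> S \<Longrightarrow> norm (G s) \<le> B * exp (\<epsilon> * Re s)"
    using assms(1) unfolding decaying_primitive_def by blast
  then show ?thesis
    using assms by (intro half_strip_decay_from_derivative[of \<phi> b L G g K c B \<epsilon>] eps) auto
qed

lemma decaying_primitive_diff:
  assumes "decaying_primitive g G" "decaying_primitive h H"
  shows "decaying_primitive (\<lambda>s. g s - h s) (\<lambda>s. G s - H s)"
proof -
  obtain A B where A: "\<And>s. s \<in> S \<Longrightarrow> norm (G s) \<le> A * exp (\<epsilon> * Re s)"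
    and B: "\<And>s. s \<in> S \<Longrightarrow> norm (H s) \<le> B * exp (\<epsilon> * Re s)"
    using assms unfolding decaying_primitive_def by blast
  have "norm (G s - H s) \<le> (A + B) * exp (\<epsilon> * Re s)" if "s \<in> S" for s
    using A[OF that] B[OF that] norm_triangle_ineq4[of "G s" "H s"] by (simp add: distrib_right)
  then show ?thesis
    using assms unfolding decaying_primitive_def
    by (auto intro!: derivative_intros)
qed

lemma decaying_primitive_holomorphic: "decaying_primitive g G \<Longrightarrow> G holomorphic_on S"
  unfolding decaying_primitive_def
  by (auto simp: holomorphic_on_open)

lemma good_prim:
  assumes "good w"
  shows "decaying_primitive w (prim w)" "s \<in> S \<Longrightarrow> norm (prim w s) \<le> exp (\<epsilon> * Re s)"
    "s \<in> S \<Longrightarrow> norm (w s) \<le> exp (\<epsilon> * Re s)" "prim w holomorphic_on S"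
proof -
  show 1: "decaying_primitive w (prim w)"
    using assms by (intro decaying_primitive_prim[of _ \<epsilon>]) (auto simp: good_def)
  show "s \<in> S \<Longrightarrow> norm (prim w s) \<le> exp (\<epsilon> * Re s)"
    using decaying_primitive_bound[OF 1, of \<epsilon> \<epsilon> s] assms eps by (auto simp: good_def)
  show "s \<in> S \<Longrightarrow> norm (w s) \<le> exp (\<epsilon> * Re s)"
    using assms eps unfolding good_def
    by (smt (verit, best) exp_gt_zero mult_less_cancel_right1)
  show "prim w holomorphic_on S" using 1 by (rule decaying_primitive_holomorphic)
qed

text \<open>The unknown of the iteration is the derivative: for a fixed point \<open>w\<close>, the
  function \<open>v = prim w\<close> satisfies \<open>v' = w\<close> and
  \<open>v'' = F s v v'\<close>.\<close>

definition "step w = prim (\<lambda>s. F s (prim w s) (w s))"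

lemma step_props:
  assumes "good w"
  shows "decaying_primitive (\<lambda>s. F s (prim w s) (w s)) (step w)" "good (step w)"
proof -
  note g = good_prim[OF assms]
  have w: "w holomorphic_on S" using assms by (simp add: good_def)
  have bd: "norm (F s (prim w s) (w s)) \<le> C * exp (2 * \<epsilon> * Re s)" if "s \<in> S" for s
    using that by (intro bound g)
  have bd1: "norm (F s (prim w s) (w s)) \<le> \<epsilon>\<^sup>2 / 2 * exp (\<epsilon> * Re s)" if "s \<in> S" for s
  proof -
    have "C * exp (\<epsilon> * Re s) * exp (\<epsilon> * Re s) \<le> \<epsilon>\<^sup>2 / 2 * exp (\<epsilon> * Re s)"
      using small_at[OF that] mult_nonneg_nonneg[OF C exp_ge_zero[of "\<epsilon> * Re s"]]
      by (intro mult_right_mono) (linarith, simp)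
    with bd[OF that] show ?thesis unfolding exp_eps_double by (simp only: mult.assoc order_trans)
  qed
  show 1: "decaying_primitive (\<lambda>s. F s (prim w s) (w s)) (step w)"
    unfolding step_def by (intro decaying_primitive_prim[OF _ bd1] holomorphic g w)
  have "norm (step w s) \<le> \<epsilon> * exp (\<epsilon> * Re s)" if "s \<in> S" for s
  proof -
    have "norm (step w s) \<le> \<epsilon>\<^sup>2 / 2 / \<epsilon> * exp (\<epsilon> * Re s)"
      by (rule decaying_primitive_bound[OF 1 bd1 eps(1) that])
    also have "\<epsilon>\<^sup>2 / 2 / \<epsilon> \<le> \<epsilon>" using eps by (simp add: power2_eq_square)
    finally show ?thesis by simp
  qed
  then show "good (step w)" using decaying_primitive_holomorphic[OF 1] by (simp add: good_def)
qed

text \<open>The first integration costs \<open>1 / \<epsilon>\<close>, so \<open>F\<close> changes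
  by at most \<open>C * exp (\<epsilon> * Re s) * (1 / \<epsilon> + 1)\<close> times
  \<open>B * exp (\<epsilon> * Re s)\<close>. Since \<open>\<epsilon> \<le> 1\<close> the bracket is
  at most \<open>2 / \<epsilon>\<close>, and \<open>small\<close> reduces the product to
  \<open>\<epsilon> / 2\<close>. The second integration divides by \<open>\<epsilon>\<close> again
  and leaves \<open>1 / 2\<close>.\<close>

lemma step_contracts:
  assumes "good w" "good w'" and le: "\<And>s. s \<in> S \<Longrightarrow> norm (w s - w' s) \<le> B * exp (\<epsilon> * Re s)"
    and "s \<in> S"
  shows "norm (prim w s - prim w' s) \<le> B / \<epsilon> * exp (\<epsilon> * Re s)"
    and "norm (step w s - step w' s) \<le> B / 2 * exp (\<epsilon> * Re s)"
proof -
  have B: "B \<ge> 0"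
    using order_trans[OF norm_ge_zero le[OF \<open>s \<in> S\<close>]] by (simp add: zero_le_mult_iff)
  have *: "norm (prim w s - prim w' s) \<le> B / \<epsilon> * exp (\<epsilon> * Re s)" if "s \<in> S" for s
    by (rule decaying_primitive_bound[OF decaying_primitive_diff[OF good_prim(1)[OF assms(1)]
          good_prim(1)[OF assms(2)]] le eps(1) that])
  show "norm (prim w s - prim w' s) \<le> B / \<epsilon> * exp (\<epsilon> * Re s)" by (rule *[OF \<open>s \<in> S\<close>])
  have "norm (F s (prim w s) (w s) - F s (prim w' s) (w' s)) \<le> (B * \<epsilon> / 2) * exp (\<epsilon> * Re s)"
    if "s \<in> S" for s
  proof -
    let ?e = "exp (\<epsilon> * Re s)"
    have "norm (F s (prim w s) (w s) - F s (prim w' s) (w' s)) \<le>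
        C * ?e * (norm (prim w s - prim w' s) + norm (w s - w' s))"
      using that by (intro lipschitz good_prim[OF assms(1)] good_prim[OF assms(2)])
    also have "\<dots> \<le> C * ?e * (B / \<epsilon> * ?e + B * ?e)"
      using C by (intro mult_left_mono add_mono * le that) auto
    also have "\<dots> \<le> C * ?e * (B / \<epsilon> * ?e + B / \<epsilon> * ?e)"
      using C B eps
      by (intro mult_left_mono add_mono mult_right_mono order_refl) (auto simp: field_simps mult_left_le)
    also have "\<dots> = (2 * C * ?e) * (B / \<epsilon> * ?e)"
      by (simp add: algebra_simps)
    finally have "norm (F s (prim w s) (w s) - F s (prim w' s) (w' s)) \<le> (2 * C * ?e) * (B / \<epsilon> * ?e)" .
    also have "\<dots> \<le> (\<epsilon>\<^sup>2 / 2) * (B / \<epsilon> * ?e)"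
      using small_at[OF that] B eps by (intro mult_right_mono) (auto simp: mult_ac)
    also have "\<dots> = (B * \<epsilon> / 2) * ?e"
      using eps by (simp add: power2_eq_square)
    finally show ?thesis .
  qed
  from decaying_primitive_bound[OF decaying_primitive_diff[OF step_props(1)[OF assms(1)]
          step_props(1)[OF assms(2)]] this eps(1) \<open>s \<in> S\<close>]
  show "norm (step w s - step w' s) \<le> B / 2 * exp (\<epsilon> * Re s)"
    using eps by simp
qed

section \<open>Successive approximation\<close>

definition "iterate n = (step ^^ n) (\<lambda>_. 0)"

lemma good_iterate: "good (iterate n)"
proof (induction n)
  case 0
  then show ?case using eps by (auto simp: iterate_def good_def)
next
  case (Suc n)
  then show ?case using step_props(2) by (simp add: iterate_def)
qed

lemma iterate_Suc_diff:
  "s \<in> S \<Longrightarrow> norm (iterate (Suc n) s - iterate n s) \<le> (1/2) ^ n * exp (\<epsilon> * Re s)"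
proof (induction n arbitrary: s)
  case 0
  have "good (iterate 1)" by (rule good_iterate)
  from good_prim(3)[OF this 0] show ?case by (simp add: iterate_def)
next
  case (Suc n)
  from step_contracts(2)[OF good_iterate[of "Suc n"] good_iterate[of n] Suc.IH Suc.prems]
  show ?case by (simp add: iterate_def)
qed

lemma iterate_diff:
  assumes "s \<in> S"
  shows "norm (iterate (n + k) s - iterate n s) \<le> 2 * (1/2) ^ n * exp (\<epsilon> * Re s)"
proof -
  \<comment> \<open>The exact partial sum of the geometric series is kept, since the final bound
    alone would not survive induction on \<open>k\<close>.\<close>
  have "norm (iterate (n + k) s - iterate n s) \<le> (2 * (1/2) ^ n - 2 * (1/2) ^ (n + k)) * exp (\<epsilon> * Re s)"
  proof (induction k)
    case (Suc k)
    have "norm (iterate (n + Suc k) s - iterate n s) \<le>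
        norm (iterate (Suc (n + k)) s - iterate (n + k) s) + norm (iterate (n + k) s - iterate n s)"
      using norm_triangle_ineq[of "iterate (Suc (n + k)) s - iterate (n + k) s" "iterate (n + k) s - iterate n s"]
      by simp
    also have "\<dots> \<le> (1/2) ^ (n + k) * exp (\<epsilon> * Re s) +
        (2 * (1/2) ^ n - 2 * (1/2) ^ (n + k)) * exp (\<epsilon> * Re s)"
      by (intro add_mono Suc iterate_Suc_diff assms)
    finally show ?case by (simp add: algebra_simps)
  qed simp
  also have "\<dots> \<le> 2 * (1/2) ^ n * exp (\<epsilon> * Re s)"
    by (intro mult_right_mono) auto
  finally show ?thesis .
qed

lemma solution_exists:
  obtains v u where
    "\<And>s. s \<in> S \<Longrightarrow> (v has_field_derivative u s) (at s)"
    "\<And>s. s \<in> S \<Longrightarrow> (u has_field_derivative F s (v s) (u s)) (at s)"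
    "\<And>s. s \<in> S \<Longrightarrow> norm (v s) \<le> exp (\<epsilon> * Re s)"
    "\<And>s. s \<in> S \<Longrightarrow> norm (u s) \<le> exp (\<epsilon> * Re s)"
proof -
  have "uniform_limit S (\<lambda>n s. \<Sum>i<n. iterate (Suc i) s - iterate i s)
      (\<lambda>s. suminf (\<lambda>i. iterate (Suc i) s - iterate i s)) sequentially"
  proof (rule Weierstrass_m_test)
    show "summable (\<lambda>i. (1/2) ^ i * exp (\<epsilon> * L))"
      by (intro summable_mult2 summable_geometric) auto
    fix n s assume s: "s \<in> S"
    have "norm (iterate (Suc n) s - iterate n s) \<le> (1/2) ^ n * exp (\<epsilon> * Re s)"
      by (rule iterate_Suc_diff[OF s])
    also have "\<dots> \<le> (1/2) ^ n * exp (\<epsilon> * L)"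
      using s eps by (intro mult_left_mono) (auto simp: half_strip_def)
    finally show "norm (iterate (Suc n) s - iterate n s) \<le> (1/2) ^ n * exp (\<epsilon> * L)" .
  qed
  moreover have "(\<Sum>i<n. iterate (Suc i) s - iterate i s) = iterate n s" for n s
    using sum_lessThan_telescope[of "\<lambda>i. iterate i s" n] by (simp add: iterate_def)
  ultimately obtain w where w: "uniform_limit S iterate w sequentially"
    by auto
  have lim: "(\<lambda>n. iterate n s) \<longlonglongrightarrow> w s" if "s \<in> S" for s
    using tendsto_uniform_limitI[OF w that] .
  have "w holomorphic_on S"
  proof (rule holomorphic_uniform_sequence[OF open_half_strip])
    show "iterate n holomorphic_on S" for n using good_iterate by (simp add: good_def)
    fix x assume "x \<in> S"
    then obtain d where "d > 0" "cball x d \<subseteq> S"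
      using open_contains_cball open_half_strip by blast
    then show "\<exists>d>0. cball x d \<subseteq> S \<and> uniform_limit (cball x d) iterate w sequentially"
      using uniform_limit_on_subset[OF w] by blast
  qed
  moreover have "norm (w s) \<le> \<epsilon> * exp (\<epsilon> * Re s)" if "s \<in> S" for s
    using good_iterate that
    by (intro Lim_bounded[OF tendsto_norm[OF lim[OF that]], of 0]) (auto simp: good_def)
  ultimately have "good w" by (simp add: good_def)
  have dist: "norm (w s - iterate n s) \<le> 2 * (1/2) ^ n * exp (\<epsilon> * Re s)" if "s \<in> S" for n s
  proof -
    have "(\<lambda>k. norm (iterate (n + k) s - iterate n s)) \<longlonglongrightarrow> norm (w s - iterate n s)"
      using LIMSEQ_ignore_initial_segment[OF lim[OF that], of n]
      by (intro tendsto_intros) (simp add: add.commute)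
    then show ?thesis by (rule Lim_bounded[of _ _ 0]) (use iterate_diff[OF that] in auto)
  qed
  \<comment> \<open>One contraction step applied to \<open>dist\<close> shows that
    \<open>iterate (Suc n)\<close> also tends to \<open>step w\<close>; its limit is
    \<open>w\<close>.\<close>
  have fixpoint: "step w s = w s" if "s \<in> S" for s
  proof -
    have "(\<lambda>n. step w s - iterate (Suc n) s) \<longlonglongrightarrow> 0"
    proof (rule Lim_null_comparison)
      show "(\<lambda>n. 2 * (1/2) ^ n / 2 * exp (\<epsilon> * Re s)) \<longlonglongrightarrow> 0" by real_asymp
      show "eventually (\<lambda>n. norm (step w s - iterate (Suc n) s) \<le> 2 * (1/2) ^ n / 2 * exp (\<epsilon> * Re s)) sequentially"
        using step_contracts(2)[OF \<open>good w\<close> good_iterate dist that]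
        by (simp add: iterate_def)
    qed
    moreover have "(\<lambda>n. step w s - iterate (Suc n) s) \<longlonglongrightarrow> step w s - w s"
      by (intro tendsto_intros LIMSEQ_Suc lim that)
    ultimately show ?thesis using LIMSEQ_unique by fastforce
  qed
  show thesis
  proof (rule that[of "prim w" w])
    fix s assume s: "s \<in> S"
    show "(prim w has_field_derivative w s) (at s)"
      using good_prim(1)[OF \<open>good w\<close>] s by (simp add: decaying_primitive_def)
    have "(step w has_field_derivative F s (prim w s) (w s)) (at s)"
      using step_props(1)[OF \<open>good w\<close>] s by (simp add: decaying_primitive_def)
    then show "(w has_field_derivative F s (prim w s) (w s)) (at s)"
      by (rule has_field_derivative_transform_within_open[OF _ open_half_strip s fixpoint])
    show "norm (prim w s) \<le> exp (\<epsilon> * Re s)" "norm (w s) \<le> exp (\<epsilon> * Re s)"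
      using good_prim(2,3)[OF \<open>good w\<close> s] by auto
  qed
qed

lemma solution_unique_on_axis:
  fixes v u v' u' :: "real \<Rightarrow> complex"
  assumes "M \<le> L"
    and "\<And>x. x < M \<Longrightarrow> (v has_vector_derivative u x) (at x)"
    and "\<And>x. x < M \<Longrightarrow> (u has_vector_derivative F (Complex x \<phi>) (v x) (u x)) (at x)"
    and "\<And>x. x < M \<Longrightarrow> norm (v x) \<le> exp (\<epsilon> * x)" "\<And>x. x < M \<Longrightarrow> norm (u x) \<le> exp (\<epsilon> * x)"
    and "\<And>x. x < M \<Longrightarrow> (v' has_vector_derivative u' x) (at x)"
    and "\<And>x. x < M \<Longrightarrow> (u' has_vector_derivative F (Complex x \<phi>) (v' x) (u' x)) (at x)"
    and "\<And>x. x < M \<Longrightarrow> norm (v' x) \<le> exp (\<epsilon> * x)" "\<And>x. x < M \<Longrightarrow> norm (u' x) \<le> exp (\<epsilon> * x)"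
  obtains M' where "M' \<le> M" "\<And>x. x < M' \<Longrightarrow> v x = v' x"
proof -
  obtain M' where "M' \<le> M" "\<And>x. x < M' \<Longrightarrow> v x - v' x = 0"
  \<comment> \<open>The third component is taken to be 0. The constant is \<open>max C 1\<close>
    because the equation \<open>(v - v')' = u - u'\<close> needs a coefficient of at least 1; the 2
    bounds a difference of two functions of size \<open>exp (\<epsilon> * x)\<close>.\<close>
  proof (rule decaying_system_trivial[of M "\<lambda>x. v x - v' x" "\<lambda>x. u x - u' x" "\<lambda>x. u x - u' x"
        "\<lambda>x. F (Complex x \<phi>) (v x) (u x) - F (Complex x \<phi>) (v' x) (u' x)" "\<lambda>_. 0" "\<lambda>_. 0"
        "max C 1" \<epsilon> 2])
    fix x assume x: "x < M"
    show "norm (u x - u' x) \<le> max C 1 * norm (u x - u' x)"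
      using mult_right_mono[of 1 "max C 1" "norm (u x - u' x)"] by simp
    show "norm (v x - v' x) \<le> 2 * exp (\<epsilon> * x)"
      using assms(4,8)[OF x] norm_triangle_ineq4[of "v x" "v' x"] by linarith
    show "norm (u x - u' x) \<le> 2 * exp (\<epsilon> * x)"
      using assms(5,9)[OF x] norm_triangle_ineq4[of "u x" "u' x"] by linarith
    have "norm (F (Complex x \<phi>) (v x) (u x) - F (Complex x \<phi>) (v' x) (u' x)) \<le>
        C * exp (\<epsilon> * Re (Complex x \<phi>)) * (norm (v x - v' x) + norm (u x - u' x))"
      using assms(4,5,8,9)[OF x] x \<open>M \<le> L\<close> b by (intro lipschitz) (auto simp: half_strip_def)
    also have "\<dots> \<le> max C 1 * exp (\<epsilon> * x) * (norm (v x - v' x) + norm (u x - u' x))"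
      by (simp add: mult_right_mono)
    finally show "norm (F (Complex x \<phi>) (v x) (u x) - F (Complex x \<phi>) (v' x) (u' x)) \<le>
      max C 1 * norm (0::complex) + max C 1 * exp (\<epsilon> * x) * (norm (v x - v' x) + norm (u x - u' x))"
      by simp
  qed (use assms eps in \<open>auto intro!: derivative_intros\<close>)
  then show thesis by (intro that[of M']) auto
qed

end

section \<open>PVI in logarithmic coordinates\<close>

text \<open>
  PVI in the variables \<open>t = 1 - x\<close>, \<open>w = 1 - y\<close>, with \<open>q\<close> and \<open>q'\<close> the first two derivatives
  of \<open>log w\<close> with respect to \<open>log t\<close>, and \<open>\<nu> = 2 \<mu> - 1\<close>.
\<close>
definition log_ode :: "complex \<Rightarrow> complex \<Rightarrow> complex \<Rightarrow> complex \<Rightarrow> complex \<Rightarrow> bool" where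
  "log_ode \<nu> t w q q' \<longleftrightarrow>
     2 * (t - 1)\<^sup>2 * (w - 1) * (w - t) * q' =
       (w - 1)\<^sup>2 * t * (t - 1) * (q - 1)\<^sup>2 - q\<^sup>2 * (w - t)\<^sup>2 * (t - 1) + \<nu>\<^sup>2 * (w - 1)\<^sup>2 * (w - t)\<^sup>2"

text \<open>Here \<open>p\<close> and \<open>r\<close> stand for the first and second derivatives of
  \<open>y\<close>. The hypotheses are the chain rule for \<open>s = log t\<close>:
  \<open>t d/dt = d/ds\<close> and \<open>t^2 (d/dt)^2 = (d/ds)^2 - d/ds\<close>, with the minus
  sign because \<open>y = 1 - w\<close>. After substitution every term carries the factor
  \<open>w^2\<close>, which is cancelled.\<close>

lemma PVI_eq_iff_log_ode:
  assumes p: "t * p = w * q" and r: "t\<^sup>2 * r = - (w * (q' + q\<^sup>2 - q))" and "w \<noteq> 0"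
  shows "PVI_eq \<mu> (1 - t) (1 - w) p r \<longleftrightarrow> log_ode (2 * \<mu> - 1) t w q q'"
proof -
  have L: "2 * (1 - t)\<^sup>2 * (1 - t - 1)\<^sup>2 * (1 - w) * (1 - w - 1) * (1 - w - (1 - t)) * r =
      w\<^sup>2 * (2 * (t - 1)\<^sup>2 * (w - 1) * (w - t) * (q' + q\<^sup>2 - q))"
  proof -
    have "2 * (1 - t)\<^sup>2 * (1 - t - 1)\<^sup>2 * (1 - w) * (1 - w - 1) * (1 - w - (1 - t)) * r =
        2 * (1 - t)\<^sup>2 * (1 - w) * (- w) * (t - w) * (t\<^sup>2 * r)"
      by (simp add: algebra_simps)
    then show ?thesis unfolding r by algebra
  qed
  have R1: "(1 - t)\<^sup>2 * (1 - t - 1)\<^sup>2 * X * p\<^sup>2 = w\<^sup>2 * ((1 - t)\<^sup>2 * X * q\<^sup>2)" for X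
  proof -
    have "(1 - t)\<^sup>2 * (1 - t - 1)\<^sup>2 * X * p\<^sup>2 = (1 - t)\<^sup>2 * X * (t * p)\<^sup>2"
      by algebra
    then show ?thesis unfolding p by algebra
  qed
  have R2: "2 * (1 - t) * (1 - t - 1) * (1 - w) * (1 - w - 1) * X * p =
      w\<^sup>2 * (2 * (1 - t) * (1 - w) * X * q)" for X
  proof -
    have "2 * (1 - t) * (1 - t - 1) * (1 - w) * (1 - w - 1) * X * p =
        2 * (1 - t) * (1 - w) * w * X * (t * p)"
      by algebra
    then show ?thesis unfolding p by algebra
  qed
  have fac: "a * b = a * c \<longleftrightarrow> b = c" if "a \<noteq> 0" for a b c :: complex
    using that by simp
  have "PVI_eq \<mu> (1 - t) (1 - w) p r \<longleftrightarrow>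
      w\<^sup>2 * (2 * (t - 1)\<^sup>2 * (w - 1) * (w - t) * q') =
      w\<^sup>2 * ((w - 1)\<^sup>2 * t * (t - 1) * (q - 1)\<^sup>2 - q\<^sup>2 * (w - t)\<^sup>2 * (t - 1)
        + (2 * \<mu> - 1)\<^sup>2 * (w - 1)\<^sup>2 * (w - t)\<^sup>2)"
    unfolding PVI_eq_def L R1 R2 by algebra
  also have "\<dots> \<longleftrightarrow> log_ode (2 * \<mu> - 1) t w q q'"
    unfolding log_ode_def using \<open>w \<noteq> 0\<close> by (intro fac) simp
  finally show ?thesis .
qed

definition log_rhs :: "complex \<Rightarrow> complex \<Rightarrow> complex \<Rightarrow> complex \<Rightarrow> complex" where
  "log_rhs \<nu> t w q =
     (w - 1) * t * (q - 1)\<^sup>2 / (2 * (w - t) * (t - 1)) - q\<^sup>2 * (w - t) / (2 * (w - 1) * (t - 1))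
     + \<nu>\<^sup>2 * (w - 1) * (w - t) / (2 * (t - 1)\<^sup>2)"

lemma log_ode_iff:
  assumes "t \<noteq> 1" "w \<noteq> 1" "w \<noteq> t"
  shows "log_ode \<nu> t w q q' \<longleftrightarrow> q' = log_rhs \<nu> t w q"
proof -
  define a b c where "a = t - 1" and "b = w - 1" and "c = w - t"
  have nz: "a \<noteq> 0" "b \<noteq> 0" "c \<noteq> 0" using assms by (auto simp: a_def b_def c_def)
  define M where "M = 2 * a\<^sup>2 * b * c"
  have M: "M \<noteq> 0" using nz by (simp add: M_def)
  have "M * log_rhs \<nu> t w q = b\<^sup>2 * t * a * (q - 1)\<^sup>2 - q\<^sup>2 * c\<^sup>2 * a + \<nu>\<^sup>2 * b\<^sup>2 * c\<^sup>2"
    unfolding log_rhs_def M_def a_def[symmetric] b_def[symmetric] c_def[symmetric]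
    using nz by (simp add: field_simps power2_eq_square)
  then have "log_ode \<nu> t w q q' \<longleftrightarrow> M * q' = M * log_rhs \<nu> t w q"
    unfolding log_ode_def M_def a_def b_def c_def by simp
  then show ?thesis using M by simp
qed

section \<open>The logarithm on the cut disc\<close>

text \<open>Rotation by \<open>cis (- \<phi>)\<close> carries the cut to the discontinuity of
  \<open>Ln\<close>; adding back \<open>\<phi>\<close> selects the logarithm of \<open>1 - x\<close>
  with imaginary part within \<open>pi\<close> of \<open>\<phi>\<close>.\<close>

definition cut_log :: "real \<Rightarrow> complex \<Rightarrow> complex" where
  "cut_log \<phi> x = Ln ((1 - x) * cis (- \<phi>)) + \<i> * of_real \<phi>"

lemma cut_power_eq: "cut_power \<phi> x p = exp (of_real p * cut_log \<phi> x)"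
  by (simp add: cut_power_def cut_log_def)

lemma norm_cut_power: "norm (cut_power \<phi> x p) = exp (p * Re (cut_log \<phi> x))"
  by (simp add: cut_power_eq)

lemma cut_disc_not_nonpos_Reals:
  assumes "x \<in> cut_disc \<phi> r"
  shows "(1 - x) * cis (- \<phi>) \<notin> \<real>\<^sub>\<le>\<^sub>0"
proof
  assume "(1 - x) * cis (- \<phi>) \<in> \<real>\<^sub>\<le>\<^sub>0"
  then obtain t where t: "(1 - x) * cis (- \<phi>) = of_real t" "t \<le> 0"
    by (auto elim: nonpos_Reals_cases)
  have "1 - x = (1 - x) * cis (- \<phi>) * cis \<phi>" by (simp add: mult.assoc cis_mult)
  then have "x = 1 + of_real (- t) * cis \<phi>" unfolding t by (simp add: algebra_simps)
  with t(2) assms show False unfolding cut_disc_def by fastforce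
qed

lemma exp_cut_log:
  assumes "x \<in> cut_disc \<phi> r"
  shows "exp (cut_log \<phi> x) = 1 - x"
proof -
  have "(1 - x) * cis (- \<phi>) \<noteq> 0" using cut_disc_not_nonpos_Reals[OF assms] by auto
  then show ?thesis
    by (simp add: cut_log_def exp_add mult.assoc cis_mult flip: cis_conv_exp)
qed

lemma cut_log_in_half_strip:
  assumes "x \<in> cut_disc \<phi> r"
  shows "cut_log \<phi> x \<in> half_strip \<phi> pi (ln r)"
proof -
  have nz: "(1 - x) * cis (- \<phi>) \<noteq> 0" using cut_disc_not_nonpos_Reals[OF assms] by auto
  have "norm (1 - x) < r" using assms by (auto simp: cut_disc_def dist_norm)
  moreover have "0 < norm (1 - x)" using nz by auto
  moreover have "\<bar>Im (Ln ((1 - x) * cis (- \<phi>)))\<bar> < pi"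
  proof -
    have "Im (Ln ((1 - x) * cis (- \<phi>))) \<noteq> pi"
      using cut_disc_not_nonpos_Reals[OF assms] Im_Ln_eq_pi[OF nz]
      by (auto simp: complex_nonpos_Reals_iff)
    then show ?thesis using mpi_less_Im_Ln[OF nz] Im_Ln_le_pi[OF nz] by linarith
  qed
  ultimately show ?thesis
    using nz ln_less_cancel_iff[of "norm (1 - x)" r] less_trans[of 0 "norm (1 - x)" r] by (simp add: half_strip_def cut_log_def norm_mult)
qed

text \<open>With \<open>exp_cut_log\<close> and \<open>cut_log_in_half_strip\<close> this makes
  \<open>cut_log \<phi>\<close> and \<open>1 - exp s\<close> mutually inverse between the cut disc
  and the half-strip.\<close>

lemma cut_disc_of_half_strip:
  assumes "s \<in> half_strip \<phi> pi (ln r)" "r > 0"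
  shows "1 - exp s \<in> cut_disc \<phi> r" "cut_log \<phi> (1 - exp s) = s"
proof -
  have rot: "exp s * cis (- \<phi>) = exp (s - \<i> * of_real \<phi>)"
    by (simp add: cis_conv_exp exp_diff exp_minus field_simps)
  have Ln: "Ln (exp s * cis (- \<phi>)) = s - \<i> * of_real \<phi>"
    unfolding rot using assms(1) by (intro Ln_exp) (auto simp: half_strip_def)
  then show "cut_log \<phi> (1 - exp s) = s" by (simp add: cut_log_def)
  have "exp (Re s) < exp (ln r)" using assms(1) unfolding exp_less_cancel_iff by (simp add: half_strip_def)
  then have "1 - exp s \<in> ball 1 r" using \<open>r > 0\<close> by (simp add: dist_norm)
  moreover have "1 - exp s \<noteq> 1 + of_real t * cis \<phi>" if "t \<ge> 0" for t
  proof
    assume "1 - exp s = 1 + of_real t * cis \<phi>"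
    then have e: "exp s = of_real (- t) * cis \<phi>" by (simp add: algebra_simps eq_neg_iff_add_eq_0)
    then have e': "exp s * cis (- \<phi>) = of_real (- t)" by (simp add: mult.assoc cis_mult)
    have "t \<noteq> 0" using e by auto
    then have "Im (Ln (exp s * cis (- \<phi>))) = pi"
      unfolding e' using that by (subst Im_Ln_eq_pi) auto
    then show False unfolding Ln using assms(1) by (auto simp: half_strip_def)
  qed
  ultimately show "1 - exp s \<in> cut_disc \<phi> r" by (auto simp: cut_disc_def)
qed

lemma open_cut_disc: "open (cut_disc \<phi> r)"
proof -
  have "{1 + of_real t * cis \<phi> | t. t \<ge> 0} = (\<lambda>x. (1 - x) * cis (- \<phi>)) -` \<real>\<^sub>\<le>\<^sub>0"
  proof (intro equalityI subsetI)
    fix x assume "x \<in> {1 + of_real t * cis \<phi> | t. t \<ge> 0}"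
    then obtain t where "t \<ge> 0" "x = 1 + of_real t * cis \<phi>" by auto
    then have "(1 - x) * cis (- \<phi>) = of_real (- t)" by (simp add: mult.assoc cis_mult)
    then show "x \<in> (\<lambda>x. (1 - x) * cis (- \<phi>)) -` \<real>\<^sub>\<le>\<^sub>0" using \<open>t \<ge> 0\<close>
      by (simp add: complex_nonpos_Reals_iff)
  next
    fix x assume "x \<in> (\<lambda>x. (1 - x) * cis (- \<phi>)) -` \<real>\<^sub>\<le>\<^sub>0"
    \<comment> \<open>The radius is chosen so that \<open>x\<close> lies in the ball; being outside
      the cut disc then places it on the ray.\<close>
    then have "x \<notin> cut_disc \<phi> (norm (x - 1) + 1)"
      using cut_disc_not_nonpos_Reals by blast
    then show "x \<in> {1 + of_real t * cis \<phi> | t. t \<ge> 0}"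
      by (auto simp: cut_disc_def dist_norm norm_minus_commute)
  qed
  moreover have "closed ((\<lambda>x. (1 - x) * cis (- \<phi>)) -` \<real>\<^sub>\<le>\<^sub>0)"
    by (intro closed_vimage closed_nonpos_Reals_complex continuous_intros)
  ultimately show ?thesis unfolding cut_disc_def by (intro open_Diff) auto
qed

text \<open>Written through \<open>cut_log\<close> instead of \<open>1 - x\<close>, so that iterated
  derivatives remain functions of the logarithm.\<close>

lemma cut_log_deriv:
  assumes "x \<in> cut_disc \<phi> r"
  shows "(cut_log \<phi> has_field_derivative - exp (- cut_log \<phi> x)) (at x)"
proof -
  have nz: "1 - x \<noteq> 0" using cut_disc_not_nonpos_Reals[OF assms] by auto
  have "(cut_log \<phi> has_field_derivative - 1 / (1 - x)) (at x)"
    unfolding cut_log_def[abs_def]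
    using cut_disc_not_nonpos_Reals[OF assms] nz
    by (auto intro!: derivative_eq_intros simp: field_simps)
  then show ?thesis unfolding exp_minus exp_cut_log[OF assms] by (simp add: divide_inverse)
qed

section \<open>Generic asymptotic data\<close>

lemma exp_near_1:
  fixes m :: real
  assumes "m > 0"
  obtains \<eta> where "\<eta> > 0" "\<And>v::complex. norm v < \<eta> \<Longrightarrow> norm (exp v - 1) \<le> m"
proof -
  have "isCont (exp :: complex \<Rightarrow> complex) 0" by simp
  then obtain \<eta> where "\<eta> > 0" "\<And>v::complex. dist v 0 < \<eta> \<Longrightarrow> dist (exp v) (exp 0) < m"
    using assms unfolding continuous_at_eps_delta by blast
  then show thesis by (intro that[of \<eta>]) (auto simp: dist_norm less_imp_le)
qed

lemma log_rhs_holomorphic: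
  assumes "T holomorphic_on S" "w holomorphic_on S" "q holomorphic_on S"
    and "\<And>s. s \<in> S \<Longrightarrow> T s \<noteq> 1" "\<And>s. s \<in> S \<Longrightarrow> w s \<noteq> 1" "\<And>s. s \<in> S \<Longrightarrow> w s \<noteq> T s"
  shows "(\<lambda>s. log_rhs \<nu> (T s) (w s) (q s)) holomorphic_on S"
proof -
  have "2 * (w s - T s) * (T s - 1) \<noteq> 0" "2 * (w s - 1) * (T s - 1) \<noteq> 0" "2 * (T s - 1)\<^sup>2 \<noteq> 0"
    if "s \<in> S" for s
    using assms(4-6)[OF that] by (simp_all only: mult_eq_0_iff right_minus_eq power_eq_0_iff) auto
  then show ?thesis
    unfolding log_rhs_def by (intro holomorphic_intros assms(1-3))
qed

text \<open>The rate is limited by the sizes of \<open>w - t\<close>, of order \<open>t\<close> to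
  the power \<open>1 - \<sigma>\<close>, and, for \<open>\<sigma> > 0\<close>, of
  \<open>t / w\<close>, of order \<open>t\<close> to the power \<open>\<sigma>\<close>. The
  condition \<open>generic\<close> prevents \<open>w - t\<close> from cancelling to leading
  order.\<close>

locale perturbed_power =
  fixes \<nu> a :: complex and \<sigma> \<phi> \<epsilon> :: real
  assumes a: "a \<noteq> 0" and \<sigma>: "0 \<le> \<sigma>" "\<sigma> < 1" and generic: "\<sigma> = 0 \<Longrightarrow> a \<noteq> 1"
    and eps: "0 < \<epsilon>" "2 * \<epsilon> \<le> 1 - \<sigma>" "\<sigma> > 0 \<Longrightarrow> 2 * \<epsilon> \<le> \<sigma>"
begin

definition W :: "complex \<Rightarrow> complex \<Rightarrow> complex" where
  "W s v = a * exp (of_real (1 - \<sigma>) * s + v)"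

definition F :: "complex \<Rightarrow> complex \<Rightarrow> complex \<Rightarrow> complex" where
  "F s v u = log_rhs \<nu> (exp s) (W s v) (of_real (1 - \<sigma>) + u)"

text \<open>Put \<open>t = exp s\<close>. Two terms of \<open>log_rhs\<close> contain the small
  factor \<open>W - t\<close>. The remaining one contains \<open>t / (W - t)\<close>, which decays
  if \<open>\<sigma> > 0\<close>; if \<open>\<sigma> = 0\<close> it is only bounded, but then
  \<open>(q - 1)^2 = u^2\<close> supplies the rate \<open>2 * \<epsilon>\<close>. The factor 3 in
  the hypotheses leaves room for Cauchy estimates.\<close>

lemma F_bound:
  obtains C L where "C \<ge> 0"
    "\<And>s v u. Re s < L \<Longrightarrow> norm v \<le> 3 * exp (\<epsilon> * Re s) \<Longrightarrow> norm u \<le> 3 * exp (\<epsilon> * Re s) \<Longrightarrow>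
       norm (F s v u) \<le> C * exp (2 * \<epsilon> * Re s)"
    "\<And>s v. Re s < L \<Longrightarrow> norm v \<le> 3 * exp (\<epsilon> * Re s) \<Longrightarrow> exp s \<noteq> 1 \<and> W s v \<noteq> 1 \<and> W s v \<noteq> exp s"
proof -
  \<comment> \<open>\<open>m\<close> keeps \<open>exp v\<close> within \<open>1/2\<close> of 1 and,
    for \<open>\<sigma> = 0\<close>, keeps \<open>a * exp v\<close> at distance at least
    \<open>norm (a - 1) / 2\<close> from 1. The resulting lower bound of \<open>W - exp s\<close>
    relative to \<open>exp ((1 - \<sigma>) * Re s)\<close> is \<open>\<kappa>\<close>; for
    \<open>\<sigma> > 0\<close> it is \<open>norm a / 2 - norm a / 4\<close>.\<close>
  define m where "m = (if \<sigma> = 0 then min (1/2) (norm (a - 1) / (2 * norm a)) else 1/2)"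
  define \<kappa> where "\<kappa> = (if \<sigma> = 0 then norm (a - 1) / 2 else norm a / 4)"
  have pos: "m > 0" "\<kappa> > 0" using generic a by (auto simp: m_def \<kappa>_def)
  obtain \<eta> where \<eta>: "\<eta> > 0" "\<And>v::complex. norm v < \<eta> \<Longrightarrow> norm (exp v - 1) \<le> m"
    using exp_near_1[OF pos(1)] by blast
  define K where "K = 2 * norm a + 1"
  define C where "C = 18 / \<kappa> + (8 + 4 * (norm \<nu>)\<^sup>2) * K"
  have K: "K > 0" by (simp add: K_def add_nonneg_pos)
  have "eventually (\<lambda>x. 3 * exp (\<epsilon> * x) \<le> min (\<eta> / 2) 1 \<and> 1 * exp (1 * x) \<le> 1/2 \<and>
      2 * norm a * exp ((1 - \<sigma>) * x) \<le> 1/2 \<and> (\<sigma> > 0 \<longrightarrow> 1 * exp (\<sigma> * x) \<le> norm a / 4)) at_bot"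
  proof (intro eventually_conj)
    show "eventually (\<lambda>x. \<sigma> > 0 \<longrightarrow> 1 * exp (\<sigma> * x) \<le> norm a / 4) at_bot"
      using eventually_exp_le[of \<sigma> "norm a / 4" 1] a by (cases "\<sigma> > 0") auto
  qed (rule eventually_exp_le; use eps \<sigma> \<eta> in simp)+
  then obtain L where L: "\<And>x. x \<le> L \<Longrightarrow> 3 * exp (\<epsilon> * x) \<le> min (\<eta> / 2) 1" "\<And>x. x \<le> L \<Longrightarrow> exp x \<le> 1/2"
    "\<And>x. x \<le> L \<Longrightarrow> 2 * norm a * exp ((1 - \<sigma>) * x) \<le> 1/2"
    "\<And>x. x \<le> L \<Longrightarrow> \<sigma> > 0 \<Longrightarrow> exp (\<sigma> * x) \<le> norm a / 4"
    unfolding eventually_at_bot_linorder by auto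
  have est: "norm (exp s - 1) \<ge> 1/2" "norm (W s v - 1) \<ge> 1/2" "norm (W s v - 1) \<le> 2"
    "norm (W s v - exp s) \<ge> \<kappa> * exp ((1 - \<sigma>) * Re s)" "norm (W s v - exp s) \<le> K * exp ((1 - \<sigma>) * Re s)"
    if s: "Re s < L" and v: "norm v \<le> 3 * exp (\<epsilon> * Re s)" for s v
  proof -
    have x: "Re s \<le> L" using s by simp
    have neg: "Re s < 0" using L(2)[OF x] by (intro exp_less_one_iff[THEN iffD1]) linarith
    have ev: "norm (exp v - 1) \<le> m" using L(1)[OF x] v \<eta> by (intro \<eta>(2)) auto
    then have ev2: "norm (exp v - 1) \<le> 1/2" by (auto simp: m_def split: if_splits)
    have evb: "norm (exp v) \<le> 2" "norm (exp v) \<ge> 1/2"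
      using ev2 norm_triangle_ineq2[of "exp v" 1] norm_triangle_ineq2[of 1 "exp v"]
      by (auto simp: norm_minus_commute)
    have W: "W s v = exp (of_real (1 - \<sigma>) * s) * (a * exp v)" by (simp add: W_def exp_add)
    have nW: "norm (W s v) \<le> 2 * norm a * exp ((1 - \<sigma>) * Re s)"
      unfolding W using evb(1) a by (simp add: norm_mult)
    with L(3)[OF x] have nW': "norm (W s v) \<le> 1/2" by linarith
    show "norm (W s v - 1) \<ge> 1/2" "norm (W s v - 1) \<le> 2"
      using nW' norm_triangle_ineq2[of 1 "W s v"] norm_triangle_ineq4[of "W s v" 1]
      by (auto simp: norm_minus_commute)
    show "norm (exp s - 1) \<ge> 1/2"
      using L(2)[OF x] norm_triangle_ineq2[of 1 "exp s"] by (auto simp: norm_minus_commute)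
    have "exp (of_real (1 - \<sigma>) * s) * exp (of_real \<sigma> * s) = exp s"
      by (simp flip: exp_add add: algebra_simps)
    then have Wt: "W s v - exp s = exp (of_real (1 - \<sigma>) * s) * (a * exp v - exp (of_real \<sigma> * s))"
      unfolding W by (simp add: right_diff_distrib)
    have "\<kappa> \<le> norm (a * exp v - exp (of_real \<sigma> * s))"
    proof (cases "\<sigma> = 0")
      case True
      have "norm (a * (exp v - 1)) \<le> norm a * (norm (a - 1) / (2 * norm a))"
        unfolding norm_mult using ev True by (intro mult_left_mono) (auto simp: m_def)
      also have "\<dots> = norm (a - 1) / 2" using a by simp
      finally show ?thesis
        using norm_triangle_ineq4[of "a * exp v - 1" "a * (exp v - 1)"] True
        by (simp add: \<kappa>_def algebra_simps)
    next
      case False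
      then have "norm (exp (of_real \<sigma> * s)) \<le> norm a / 4" using L(4)[OF x] \<sigma> by simp
      moreover have "norm (a * exp v) \<ge> norm a * (1/2)"
        unfolding norm_mult using evb by (intro mult_left_mono) auto
      ultimately show ?thesis
        using norm_triangle_ineq2[of "a * exp v" "exp (of_real \<sigma> * s)"] False
        by (simp add: \<kappa>_def)
    qed
    then show "norm (W s v - exp s) \<ge> \<kappa> * exp ((1 - \<sigma>) * Re s)"
      unfolding Wt norm_mult by (simp add: mult.commute)
    have "exp (Re s) \<le> exp ((1 - \<sigma>) * Re s)" using neg \<sigma> by (simp add: algebra_simps mult_nonneg_nonpos)
    moreover have "norm (W s v - exp s) \<le> norm (W s v) + exp (Re s)"
      using norm_triangle_ineq4[of "W s v" "exp s"] by simp
    ultimately show "norm (W s v - exp s) \<le> K * exp ((1 - \<sigma>) * Re s)"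
      using nW unfolding K_def distrib_right by linarith
  qed
  have ne: "exp s \<noteq> 1 \<and> W s v \<noteq> 1 \<and> W s v \<noteq> exp s"
    if "Re s < L" "norm v \<le> 3 * exp (\<epsilon> * Re s)" for s v
  proof -
    have "0 < \<kappa> * exp ((1 - \<sigma>) * Re s)" using pos by simp
    with est[OF that] show ?thesis by auto
  qed
  have "norm (F s v u) \<le> C * exp (2 * \<epsilon> * Re s)"
    if s: "Re s < L" and v: "norm v \<le> 3 * exp (\<epsilon> * Re s)" and u: "norm u \<le> 3 * exp (\<epsilon> * Re s)" for s v u
  proof -
    define q :: complex where "q = of_real (1 - \<sigma>) + u"
    define E where "E = exp ((1 - \<sigma>) * Re s)"
    note e = est[OF s v, folded E_def]
    have E: "E > 0" by (simp add: E_def)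
    have x: "Re s \<le> L" using s by simp
    have neg: "Re s < 0" using L(2)[OF x] by (intro exp_less_one_iff[THEN iffD1]) linarith
    have E2: "E \<le> exp (2 * \<epsilon> * Re s)"
      using eps(2) neg by (simp add: E_def mult_right_mono_neg)
    have u1: "norm u \<le> 1" using u L(1)[OF x] by simp
    have q: "norm q \<le> 2"
      using norm_triangle_ineq[of "of_real (1 - \<sigma>)" u] u1 \<sigma> by (simp add: q_def del: of_real_diff)
    have q1: "exp (\<sigma> * Re s) * (norm (q - 1))\<^sup>2 \<le> 9 * exp (2 * \<epsilon> * Re s)"
    proof (cases "\<sigma> = 0")
      case True
      have "(norm u)\<^sup>2 \<le> (3 * exp (\<epsilon> * Re s))\<^sup>2" using u by (intro power_mono) auto
      also have "\<dots> = 9 * exp (2 * \<epsilon> * Re s)" by (simp add: power_mult_distrib flip: exp_double)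
      finally show ?thesis using True by (simp add: q_def)
    next
      case False
      have "q - 1 = u - of_real \<sigma>" by (simp add: q_def)
      then have "norm (q - 1) \<le> 2" using norm_triangle_ineq4[of u "of_real \<sigma>"] u1 \<sigma> by simp
      then have "(norm (q - 1))\<^sup>2 \<le> 2\<^sup>2" by (intro power_mono) auto
      moreover have "exp (\<sigma> * Re s) \<le> exp (2 * \<epsilon> * Re s)"
        using eps(3) False \<sigma> neg by (simp add: mult_right_mono_neg)
      ultimately have "exp (\<sigma> * Re s) * (norm (q - 1))\<^sup>2 \<le> exp (2 * \<epsilon> * Re s) * 2\<^sup>2"
        by (intro mult_mono) auto
      then show ?thesis by (simp add: order_trans[OF _ mult_right_mono[of 4 9]])
    qed
    have Ts: "exp (Re s) = E * exp (\<sigma> * Re s)" by (simp add: E_def algebra_simps flip: exp_add)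
    have t1: "norm ((W s v - 1) * exp s * (q - 1)\<^sup>2 / (2 * (W s v - exp s) * (exp s - 1))) \<le>
        18 / \<kappa> * exp (2 * \<epsilon> * Re s)"
    proof -
      have "norm ((W s v - 1) * exp s * (q - 1)\<^sup>2 / (2 * (W s v - exp s) * (exp s - 1))) =
          norm (W s v - 1) * exp (Re s) * (norm (q - 1))\<^sup>2 / (2 * norm (W s v - exp s) * norm (exp s - 1))"
        by (simp only: norm_divide norm_mult norm_power norm_numeral norm_exp_eq_Re)
      also have "\<dots> \<le> 2 * exp (Re s) * (norm (q - 1))\<^sup>2 / (2 * (\<kappa> * E) * (1/2))"
        using e E pos by (intro frac_le mult_mono mult_nonneg_nonneg mult_pos_pos) auto
      also have "\<dots> = 2 / \<kappa> * (exp (\<sigma> * Re s) * (norm (q - 1))\<^sup>2)"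
        unfolding Ts using E by (simp add: field_simps)
      also have "\<dots> \<le> 2 / \<kappa> * (9 * exp (2 * \<epsilon> * Re s))"
        using pos by (intro mult_left_mono q1) auto
      finally show ?thesis by simp
    qed
    have t2: "norm (q\<^sup>2 * (W s v - exp s) / (2 * (W s v - 1) * (exp s - 1))) \<le> 8 * K * exp (2 * \<epsilon> * Re s)"
    proof -
      have "norm (q\<^sup>2 * (W s v - exp s) / (2 * (W s v - 1) * (exp s - 1))) =
          (norm q)\<^sup>2 * norm (W s v - exp s) / (2 * norm (W s v - 1) * norm (exp s - 1))"
        by (simp only: norm_divide norm_mult norm_power norm_numeral)
      also have "\<dots> \<le> 2\<^sup>2 * (K * E) / (2 * (1/2) * (1/2))"
        using e E q K by (intro frac_le mult_mono power_mono mult_nonneg_nonneg mult_pos_pos) auto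
      also have "\<dots> = 8 * K * E" by simp
      also have "\<dots> \<le> 8 * K * exp (2 * \<epsilon> * Re s)" using K E2 by (intro mult_left_mono) auto
      finally show ?thesis .
    qed
    have t3: "norm (\<nu>\<^sup>2 * (W s v - 1) * (W s v - exp s) / (2 * (exp s - 1)\<^sup>2)) \<le>
        4 * (norm \<nu>)\<^sup>2 * K * exp (2 * \<epsilon> * Re s)"
    proof -
      have "norm (\<nu>\<^sup>2 * (W s v - 1) * (W s v - exp s) / (2 * (exp s - 1)\<^sup>2)) =
          (norm \<nu>)\<^sup>2 * norm (W s v - 1) * norm (W s v - exp s) / (2 * (norm (exp s - 1))\<^sup>2)"
        by (simp add: norm_divide norm_mult norm_power)
      also have "\<dots> \<le> (norm \<nu>)\<^sup>2 * 2 * (K * E) / (2 * (1/2)\<^sup>2)"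
        using e E K by (intro frac_le mult_mono power_mono mult_nonneg_nonneg mult_pos_pos) auto
      also have "\<dots> = 4 * (norm \<nu>)\<^sup>2 * K * E" by (simp add: power2_eq_square)
      also have "\<dots> \<le> 4 * (norm \<nu>)\<^sup>2 * K * exp (2 * \<epsilon> * Re s)" using K E2 by (intro mult_left_mono) auto
      finally show ?thesis .
    qed
    have tri: "norm (x - y + z) \<le> norm x + norm y + norm z" for x y z :: complex
      using norm_triangle_ineq[of "x - y" z] norm_triangle_ineq4[of x y] by linarith
    have "norm (F s v u) \<le> 18 / \<kappa> * exp (2 * \<epsilon> * Re s) + 8 * K * exp (2 * \<epsilon> * Re s)
        + 4 * (norm \<nu>)\<^sup>2 * K * exp (2 * \<epsilon> * Re s)"
      unfolding F_def log_rhs_def q_def[symmetric]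
      by (rule order_trans[OF tri]) (intro add_mono t1 t2 t3)
    also have "\<dots> = C * exp (2 * \<epsilon> * Re s)" by (simp add: C_def distrib_left distrib_right)
    finally show ?thesis .
  qed
  moreover have "C \<ge> 0" using pos K by (simp add: C_def)
  ultimately show thesis using that ne by blast
qed

lemma F_half_strip_ode:
  assumes "b > 0"
  obtains C L where "\<And>M. M \<le> L \<Longrightarrow> half_strip_ode \<phi> b M \<epsilon> C F"
    "\<And>s v. Re s < L \<Longrightarrow> norm v \<le> 3 * exp (\<epsilon> * Re s) \<Longrightarrow> exp s \<noteq> 1 \<and> W s v \<noteq> 1 \<and> W s v \<noteq> exp s"
proof -
  obtain C L where C: "C \<ge> 0"
    and bd: "\<And>s v u. Re s < L \<Longrightarrow> norm v \<le> 3 * exp (\<epsilon> * Re s) \<Longrightarrow> norm u \<le> 3 * exp (\<epsilon> * Re s) \<Longrightarrow>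
       norm (F s v u) \<le> C * exp (2 * \<epsilon> * Re s)"
    and ne: "\<And>s v. Re s < L \<Longrightarrow> norm v \<le> 3 * exp (\<epsilon> * Re s) \<Longrightarrow> exp s \<noteq> 1 \<and> W s v \<noteq> 1 \<and> W s v \<noteq> exp s"
    using F_bound by blast
  have le3: "x \<le> 3 * exp y" if "x \<le> exp y" for x y :: real
    using that exp_gt_zero[of y] by linarith
  have "eventually (\<lambda>x. 4 * C * exp (\<epsilon> * x) \<le> \<epsilon>\<^sup>2) at_bot"
    using eps by (intro eventually_exp_le) auto
  then obtain L' where L': "\<And>x. x \<le> L' \<Longrightarrow> 4 * C * exp (\<epsilon> * x) \<le> \<epsilon>\<^sup>2"
    unfolding eventually_at_bot_linorder by blast
  have "half_strip_ode \<phi> b M \<epsilon> C F" if M: "M \<le> min L L'" for M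
  proof
    show "4 * C * exp (\<epsilon> * M) \<le> \<epsilon>\<^sup>2" using L' M by simp
    show "\<epsilon> \<le> 1" using eps \<sigma> by linarith
    fix s v u :: complex assume s: "s \<in> half_strip \<phi> b M" and v: "norm v \<le> exp (\<epsilon> * Re s)" and u: "norm u \<le> exp (\<epsilon> * Re s)"
    have sL: "Re s < L" using s M by (auto simp: half_strip_def)
    show "norm (F s v u) \<le> C * exp (2 * \<epsilon> * Re s)" by (intro bd sL le3 v u)
    fix v' u' :: complex assume v': "norm v' \<le> exp (\<epsilon> * Re s)" and u': "norm u' \<le> exp (\<epsilon> * Re s)"
    let ?\<rho> = "exp (\<epsilon> * Re s)"
    have quot: "C * exp (2 * \<epsilon> * Re s) / ?\<rho> = C * ?\<rho>"
    proof -
      have "exp (2 * \<epsilon> * Re s) = ?\<rho> * ?\<rho>"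
        using exp_double[of "\<epsilon> * Re s"] by (simp add: power2_eq_square mult.assoc)
      then show ?thesis by (simp only: mult.assoc[symmetric] times_divide_eq_right nonzero_mult_div_cancel_right exp_not_eq_zero not_False_eq_True)
    qed
    have nz: "exp s \<noteq> 1 \<and> W s v \<noteq> 1 \<and> W s v \<noteq> exp s" if "v \<in> ball 0 (3 * ?\<rho>)" for v
      using ne[OF sL, of v] that by simp
    have holv: "(\<lambda>v. F s v u) holomorphic_on ball 0 (3 * ?\<rho>)"
      unfolding F_def
    proof (rule log_rhs_holomorphic)
      show "(\<lambda>v. W s v) holomorphic_on ball 0 (3 * ?\<rho>)"
        unfolding W_def by (intro holomorphic_intros)
    qed (use nz in \<open>blast intro: holomorphic_on_const\<close>)+
    have holu: "(\<lambda>u. F s v' u) holomorphic_on ball 0 (3 * ?\<rho>)"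
      unfolding F_def
      by (rule log_rhs_holomorphic) (use ne[OF sL le3[OF v']] in \<open>auto intro!: holomorphic_intros\<close>)
    have "norm (F s v u - F s v' u) \<le> C * exp (2 * \<epsilon> * Re s) / ?\<rho> * norm (v - v')"
      by (rule holomorphic_lipschitz_ball[OF holv _ _ v v'])
         (use bd[OF sL _ le3[OF u]] in \<open>auto simp: less_imp_le\<close>)
    moreover have "norm (F s v' u - F s v' u') \<le> C * exp (2 * \<epsilon> * Re s) / ?\<rho> * norm (u - u')"
      by (rule holomorphic_lipschitz_ball[OF holu _ _ u u'])
         (use bd[OF sL le3[OF v']] in \<open>auto simp: less_imp_le\<close>)
    ultimately show "norm (F s v u - F s v' u') \<le> C * ?\<rho> * (norm (v - v') + norm (u - u'))"
      using norm_triangle_ineq[of "F s v u - F s v' u" "F s v' u - F s v' u'"]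
      unfolding quot by (simp add: distrib_left)
  next
    fix v u assume hol: "v holomorphic_on half_strip \<phi> b M" "u holomorphic_on half_strip \<phi> b M"
      and bds: "\<And>s. s \<in> half_strip \<phi> b M \<Longrightarrow> norm (v s) \<le> exp (\<epsilon> * Re s)"
    have ne': "exp s \<noteq> 1" "W s (v s) \<noteq> 1" "W s (v s) \<noteq> exp s" if "s \<in> half_strip \<phi> b M" for s
      using ne[of s "v s"] le3[OF bds[OF that]] that M by (auto simp: half_strip_def)
    have Whol: "(\<lambda>s. W s (v s)) holomorphic_on half_strip \<phi> b M"
      unfolding W_def by (intro holomorphic_intros hol)
    show "(\<lambda>s. F s (v s) (u s)) holomorphic_on half_strip \<phi> b M"
      unfolding F_def
      by (rule log_rhs_holomorphic) (use ne' hol Whol in \<open>auto intro!: holomorphic_intros\<close>)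
  qed (use C eps assms in auto)
  then show thesis using that[of "min L L'" C] ne by auto
qed

end

lemma norm_exp_minus_1_le:
  fixes z :: complex
  assumes "norm z \<le> 1/2"
  shows "norm (exp z - 1) \<le> 2 * norm z"
proof -
  have "norm (exp z - exp 0) \<le> 2 * norm (z - 0)"
  proof (rule field_differentiable_bound[of "cball 0 (1/2)" exp exp])
    fix w :: complex assume "w \<in> cball 0 (1/2)"
    then have "Re w \<le> 1/2" using complex_Re_le_cmod[of w] by simp
    then have "exp (Re w) \<le> exp (1/2)" by simp
    then show "norm (exp w) \<le> 2" using exp_half_le2 unfolding norm_exp_eq_Re by linarith
    show "(exp has_field_derivative exp w) (at w within cball 0 (1/2))"
      by (auto intro!: derivative_eq_intros)
  qed (use assms in auto)
  then show ?thesis by simp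
qed

section \<open>Translation between branches and logarithmic solutions\<close>

lemma PVI_branch_of_log_solution:
  assumes "M \<le> 0" "a \<noteq> 0"
    and dv: "\<And>s. s \<in> half_strip \<phi> pi M \<Longrightarrow> (v has_field_derivative u s) (at s)"
    and du: "\<And>s. s \<in> half_strip \<phi> pi M \<Longrightarrow> (u has_field_derivative u' s) (at s)"
    and ode: "\<And>s. s \<in> half_strip \<phi> pi M \<Longrightarrow> log_ode (2 * \<mu> - 1) (exp s) (a * exp (c * s + v s)) (c + u s) (u' s)"
  shows "PVI_branch \<mu> \<phi> (exp M) (\<lambda>x. 1 - a * exp (c * cut_log \<phi> x + v (cut_log \<phi> x)))"
proof -
  let ?D = "cut_disc \<phi> (exp M)" and ?l = "cut_log \<phi>"
  define w where "w s = a * exp (c * s + v s)" for s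
  define q where "q s = c + u s" for s
  define y where "y x = 1 - w (?l x)" for x
  \<comment> \<open>Since \<open>d/dx = - exp (- s) d/ds\<close> at
    \<open>s = cut_log \<phi> x\<close>, these are the two derivatives of \<open>y = 1 - w\<close>
    expressed through \<open>s\<close>.\<close>
  define y1 where "y1 x = w (?l x) * q (?l x) * exp (- ?l x)" for x
  define y2 where "y2 x = - (w (?l x) * (u' (?l x) + (q (?l x))\<^sup>2 - q (?l x))) * exp (- ?l x) * exp (- ?l x)" for x
  have mem: "?l x \<in> half_strip \<phi> pi M" if "x \<in> ?D" for x
    using cut_log_in_half_strip[OF that] by simp
  have dw: "(w has_field_derivative w s * q s) (at s)" if "s \<in> half_strip \<phi> pi M" for s
    unfolding w_def q_def
    by (rule derivative_eq_intros dv[OF that] refl)+ (simp add: algebra_simps)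
  have dy: "(y has_field_derivative y1 x) (at x)" if "x \<in> ?D" for x
    unfolding y_def y1_def
    by (rule derivative_eq_intros DERIV_chain2[OF dw[OF mem[OF that]] cut_log_deriv[OF that]] refl)+ simp
  have dy1: "(y1 has_field_derivative y2 x) (at x)" if "x \<in> ?D" for x
    unfolding y1_def y2_def
    by (rule derivative_eq_intros DERIV_chain2[OF dw[OF mem[OF that]] cut_log_deriv[OF that]]
        DERIV_chain2[OF du[OF mem[OF that]] cut_log_deriv[OF that]] cut_log_deriv[OF that] refl
        | simp only: q_def)+
       (simp add: q_def algebra_simps power2_eq_square)
  have dd: "deriv y x = y1 x" if "x \<in> ?D" for x using dy[OF that] by (rule DERIV_imp_deriv)
  have ddd: "deriv (deriv y) x = y2 x" if "x \<in> ?D" for x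
    by (rule DERIV_imp_deriv, rule has_field_derivative_transform_within_open[OF dy1[OF that] open_cut_disc that])
       (simp add: dd)
  have "PVI_eq \<mu> x (y x) (deriv y x) (deriv (deriv y) x)" if x: "x \<in> ?D" for x
  proof -
    let ?s = "?l x"
    have ex: "exp ?s = 1 - x" by (rule exp_cut_log[OF x])
    have "PVI_eq \<mu> (1 - exp ?s) (1 - w ?s) (y1 x) (y2 x) \<longleftrightarrow> log_ode (2 * \<mu> - 1) (exp ?s) (w ?s) (q ?s) (u' ?s)"
    proof (rule PVI_eq_iff_log_ode)
      have c: "exp ?s * (X * exp (- ?s)) = X" for X by (simp add: exp_minus)
      show "exp ?s * y1 x = w ?s * q ?s" unfolding y1_def by (rule c)
      show "(exp ?s)\<^sup>2 * y2 x = - (w ?s * (u' ?s + (q ?s)\<^sup>2 - q ?s))"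
        unfolding y2_def power2_eq_square mult.assoc[of "exp ?s" "exp ?s"] c ..
    qed (simp add: w_def \<open>a \<noteq> 0\<close>)
    with ode[OF mem[OF x]] have "PVI_eq \<mu> (1 - exp ?s) (1 - w ?s) (y1 x) (y2 x)"
      by (simp add: w_def q_def)
    then show ?thesis by (simp add: dd ddd x ex y_def)
  qed
  moreover have "y holomorphic_on ?D" using dy open_cut_disc by (auto simp: holomorphic_on_open)
  ultimately show ?thesis
    using \<open>M \<le> 0\<close> unfolding PVI_branch_def y_def w_def by auto
qed

text \<open>\<open>v\<close> is the logarithm of
  \<open>g = (1 - y) / (a * exp ((1 - \<sigma>) * s))\<close>. This quotient inherits holomorphy
  from \<open>y\<close>, while \<open>g = 1 + h\<close> gives the decay; \<open>h\<close> itself is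
  known only through its size.\<close>

lemma log_solution_of_PVI_branch:
  assumes br: "PVI_branch \<mu> \<phi> r y" and as: "asymp_at_1 a \<sigma> \<phi> r y" and a: "a \<noteq> 0"
  obtains e B L v where "e > 0" "B \<ge> 0" "L \<le> ln r" "v holomorphic_on half_strip \<phi> pi L"
    "\<And>s. s \<in> half_strip \<phi> pi L \<Longrightarrow> norm (v s) \<le> B * exp (e * Re s)"
    "\<And>s. s \<in> half_strip \<phi> pi L \<Longrightarrow> y (1 - exp s) = 1 - a * exp (of_real (1 - \<sigma>) * s + v s)"
    "\<And>s. s \<in> half_strip \<phi> pi L \<Longrightarrow> log_ode (2 * \<mu> - 1) (exp s) (a * exp (of_real (1 - \<sigma>) * s + v s))
       (of_real (1 - \<sigma>) + deriv v s) (deriv (deriv v) s)"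
proof -
  let ?D = "cut_disc \<phi> r"
  define k :: complex where "k = of_real (1 - \<sigma>)"
  have r: "r > 0" and hol: "y holomorphic_on ?D"
    and eq: "\<And>x. x \<in> ?D \<Longrightarrow> PVI_eq \<mu> x (y x) (deriv y x) (deriv (deriv y) x)"
    using br by (auto simp: PVI_branch_def)
  obtain e h where e: "e > 0" and bigo: "h \<in> O[at 1 within ?D](\<lambda>x. cut_power \<phi> x e)"
    and yh: "\<And>x. x \<in> ?D \<Longrightarrow> y x = 1 - a * cut_power \<phi> x (1 - \<sigma>) * (1 + h x)"
    using as by (auto simp: asymp_at_1_def)
  from landau_o.bigE[OF bigo] obtain c where c: "c > 0"
    "eventually (\<lambda>x. norm (h x) \<le> c * norm (cut_power \<phi> x e)) (at 1 within ?D)" by blast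
  then obtain d where d: "d > 0"
    "\<And>x. x \<in> ?D \<Longrightarrow> x \<noteq> 1 \<Longrightarrow> dist x 1 < d \<Longrightarrow> norm (h x) \<le> c * norm (cut_power \<phi> x e)"
    unfolding eventually_at by blast
  \<comment> \<open>The bound \<open>1/4\<close> on \<open>h\<close> keeps \<open>1 + h\<close> in
    the right half-plane, off the cut of \<open>Ln\<close>, and allows
    \<open>norm (Ln (1 + h)) \<le> 2 * norm h\<close>.\<close>
  have "eventually (\<lambda>x. c * exp (e * x) \<le> 1/4) at_bot" using e by (intro eventually_exp_le) auto
  then obtain L0 where L0: "\<And>x. x \<le> L0 \<Longrightarrow> c * exp (e * x) \<le> 1/4"
    unfolding eventually_at_bot_linorder by blast
  define L where "L = min (min (ln r) (ln d)) L0"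
  let ?S = "half_strip \<phi> pi L"
  have memr: "s \<in> half_strip \<phi> pi (ln r)" if "s \<in> ?S" for s
    using that by (auto simp: half_strip_def L_def)
  note memD = cut_disc_of_half_strip(1)[OF memr r]
  define g where "g s = (1 - y (1 - exp s)) / (a * exp (k * s))" for s
  define v where "v s = Ln (g s)" for s
  have gh: "g s = 1 + h (1 - exp s)" if "s \<in> ?S" for s
    using yh[OF memD[OF that]] cut_disc_of_half_strip(2)[OF memr[OF that] r] a
    by (simp add: g_def cut_power_eq k_def)
  have hb: "norm (h (1 - exp s)) \<le> c * exp (e * Re s)" if s: "s \<in> ?S" for s
  proof -
    have "exp (Re s) < exp (ln d)" using s unfolding exp_less_cancel_iff by (simp add: half_strip_def L_def)
    then have "dist (1 - exp s) 1 < d" using d(1) by (simp add: dist_norm)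
    from d(2)[OF memD[OF s] _ this] show ?thesis
      by (simp add: norm_cut_power cut_disc_of_half_strip(2)[OF memr[OF s] r])
  qed
  have h4: "norm (h (1 - exp s)) \<le> 1/4" if "s \<in> ?S" for s
    using hb[OF that] L0[of "Re s"] that by (auto simp: half_strip_def L_def)
  have g0: "g s \<notin> \<real>\<^sub>\<le>\<^sub>0" if "s \<in> ?S" for s
    using h4[OF that] abs_Re_le_cmod[of "h (1 - exp s)"] unfolding gh[OF that]
    by (auto simp: complex_nonpos_Reals_iff)
  have "g holomorphic_on ?S"
    unfolding g_def using a memD
    by (intro holomorphic_intros holomorphic_on_compose_gen[OF _ hol, unfolded o_def]) auto
  then have vhol: "v holomorphic_on ?S"
    unfolding v_def[abs_def] using g0 by (intro holomorphic_intros) auto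
  have vb: "norm (v s) \<le> 2 * c * exp (e * Re s)" if "s \<in> ?S" for s
    using norm_Ln_le[of "h (1 - exp s)"] h4[OF that] hb[OF that] by (simp add: v_def gh that)
  define w where "w s = a * exp (k * s + v s)" for s
  have yw: "y (1 - exp s) = 1 - w s" if "s \<in> ?S" for s
  proof -
    have "exp (v s) = g s" unfolding v_def using g0[OF that] by (intro exp_Ln) auto
    then show ?thesis using a by (simp add: w_def exp_add g_def)
  qed
  have w0: "w s \<noteq> 0" for s using a by (simp add: w_def)
  define q where "q s = k + deriv v s" for s
  have dv: "(v has_field_derivative deriv v s) (at s)" if "s \<in> ?S" for s
    by (rule holomorphic_derivI[OF vhol open_half_strip that])
  have ddv: "(deriv v has_field_derivative deriv (deriv v) s) (at s)" if "s \<in> ?S" for s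
    by (rule holomorphic_derivI[OF holomorphic_deriv[OF vhol open_half_strip] open_half_strip that])
  have dw: "(w has_field_derivative w s * q s) (at s)" if "s \<in> ?S" for s
    unfolding w_def q_def
    by (rule derivative_eq_intros dv[OF that] refl)+ (simp add: algebra_simps)
  have dwq: "((\<lambda>s. w s * q s) has_field_derivative w s * (deriv (deriv v) s + (q s)\<^sup>2)) (at s)"
    if "s \<in> ?S" for s
    unfolding q_def
    by (rule derivative_eq_intros dw[OF that] ddv[OF that] refl)+
       (simp add: q_def algebra_simps power2_eq_square)
  have dexp: "((\<lambda>s. 1 - exp s) has_field_derivative - exp s) (at s)" for s :: complex
    by (auto intro!: derivative_eq_intros)
  \<comment> \<open>This and the next fact are the hypotheses of \<open>PVI_eq_iff_log_ode\<close>,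
    obtained by differentiating \<open>y (1 - exp s) = 1 - w s\<close> in two ways.\<close>
  have 1: "exp s * deriv y (1 - exp s) = w s * q s" if s: "s \<in> ?S" for s
  proof -
    have "((\<lambda>s. y (1 - exp s)) has_field_derivative deriv y (1 - exp s) * (- exp s)) (at s)"
      by (rule DERIV_chain2[OF holomorphic_derivI[OF hol open_cut_disc memD[OF s]] dexp])
    then have "((\<lambda>s. 1 - w s) has_field_derivative deriv y (1 - exp s) * (- exp s)) (at s)"
      by (rule has_field_derivative_transform_within_open[OF _ open_half_strip s yw])
    moreover have "((\<lambda>s. 1 - w s) has_field_derivative - (w s * q s)) (at s)"
      using dw[OF s] by (auto intro!: derivative_eq_intros)
    ultimately show ?thesis using DERIV_unique by (fastforce simp: mult.commute)
  qed
  have 2: "(exp s)\<^sup>2 * deriv (deriv y) (1 - exp s) = - (w s * (deriv (deriv v) s + (q s)\<^sup>2 - q s))"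
    if s: "s \<in> ?S" for s
  proof -
    have "((\<lambda>s. deriv y (1 - exp s)) has_field_derivative deriv (deriv y) (1 - exp s) * (- exp s)) (at s)"
      by (rule DERIV_chain2[OF holomorphic_derivI[OF holomorphic_deriv[OF hol open_cut_disc] open_cut_disc memD[OF s]] dexp])
    then have "((\<lambda>s. exp s * deriv y (1 - exp s)) has_field_derivative
        exp s * deriv y (1 - exp s) - (exp s)\<^sup>2 * deriv (deriv y) (1 - exp s)) (at s)"
      by (auto intro!: derivative_eq_intros simp: power2_eq_square algebra_simps)
    then have "((\<lambda>s. w s * q s) has_field_derivative
        exp s * deriv y (1 - exp s) - (exp s)\<^sup>2 * deriv (deriv y) (1 - exp s)) (at s)"
      by (rule has_field_derivative_transform_within_open[OF _ open_half_strip s 1])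
    from DERIV_unique[OF this dwq[OF s]] show ?thesis unfolding 1[OF s] by (simp add: algebra_simps)
  qed
  show thesis
  proof (rule that[of e "2 * c" L v])
    fix s assume s: "s \<in> ?S"
    show "y (1 - exp s) = 1 - a * exp (of_real (1 - \<sigma>) * s + v s)"
      using yw[OF s] by (simp add: w_def k_def)
    show "log_ode (2 * \<mu> - 1) (exp s) (a * exp (of_real (1 - \<sigma>) * s + v s))
       (of_real (1 - \<sigma>) + deriv v s) (deriv (deriv v) s)"
      using eq[OF memD[OF s]] PVI_eq_iff_log_ode[OF 1[OF s] 2[OF s] w0, of \<mu>]
      unfolding yw[OF s] by (simp add: w_def k_def q_def)
  qed (use e c vhol vb in \<open>auto simp: L_def\<close>)
qed

text \<open>Lowering the rate from \<open>e\<close> to \<open>\<epsilon>\<close> lets the spare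
  factor \<open>exp ((e - \<epsilon>) * x)\<close> absorb the constant, including the factor
  \<open>exp e\<close> from Cauchy's estimate. The unit margin of that estimate fits around the axis
  because \<open>pi > 1\<close>.\<close>

lemma axis_bounds:
  assumes hol: "v holomorphic_on half_strip \<phi> pi L" and "B \<ge> 0"
    and bd: "\<And>s. s \<in> half_strip \<phi> pi L \<Longrightarrow> norm (v s) \<le> B * exp (e * Re s)"
    and "0 < \<epsilon>" "\<epsilon> < e"
  obtains L' where "L' \<le> L" "\<And>x. x < L' \<Longrightarrow> norm (v (Complex x \<phi>)) \<le> exp (\<epsilon> * x)"
    "\<And>x. x < L' \<Longrightarrow> norm (deriv v (Complex x \<phi>)) \<le> exp (\<epsilon> * x)"
proof -
  define K where "K = B * exp e"
  have "eventually (\<lambda>x. K * exp ((e - \<epsilon>) * x) \<le> 1) at_bot"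
    using assms by (intro eventually_exp_le) auto
  then obtain L0 where L0: "\<And>x. x \<le> L0 \<Longrightarrow> K * exp ((e - \<epsilon>) * x) \<le> 1"
    unfolding eventually_at_bot_linorder by blast
  have small: "K * exp (e * x) \<le> exp (\<epsilon> * x)" if "x \<le> L0" for x
  proof -
    have "K * exp (e * x) = K * exp ((e - \<epsilon>) * x) * exp (\<epsilon> * x)"
      by (simp add: algebra_simps flip: exp_add)
    also have "\<dots> \<le> 1 * exp (\<epsilon> * x)" using L0[OF that] by (intro mult_right_mono) auto
    finally show ?thesis by simp
  qed
  have BK: "B \<le> K" using assms by (simp add: K_def mult_le_cancel_left1)
  show thesis
  proof (rule that[of "min (L - 1) L0"])
    fix x assume x: "x < min (L - 1) L0"
    have "norm (v (Complex x \<phi>)) \<le> B * exp (e * x)"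
      using bd[of "Complex x \<phi>"] x by (simp add: half_strip_def)
    also have "\<dots> \<le> K * exp (e * x)" using BK by (intro mult_right_mono) auto
    also have "\<dots> \<le> exp (\<epsilon> * x)" using x by (intro small) auto
    finally show "norm (v (Complex x \<phi>)) \<le> exp (\<epsilon> * x)" .
    have "norm (deriv v (Complex x \<phi>)) \<le> B * exp e * exp (e * Re (Complex x \<phi>))"
      using x assms pi_gt3 by (intro deriv_bound_half_strip[OF hol _ _ bd]) (auto simp: half_strip_def)
    also have "\<dots> \<le> exp (\<epsilon> * x)" using small[of x] x by (simp add: K_def)
    finally show "norm (deriv v (Complex x \<phi>)) \<le> exp (\<epsilon> * x)" .
  qed auto
qed

text \<open>A half-line of the axis accumulates inside the strip, so the identity theorem
  applies.\<close>

lemma eq_of_eq_on_axis: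
  assumes f: "f holomorphic_on half_strip \<phi> b L" and g: "g holomorphic_on half_strip \<phi> b L" and "b > 0"
    and eq: "\<And>x. x < M \<Longrightarrow> f (Complex x \<phi>) = g (Complex x \<phi>)" and s: "s \<in> half_strip \<phi> b L"
  shows "f s = g s"
proof -
  define m where "m = min L M"
  define U where "U = {Complex x \<phi> | x. x < m}"
  have "f s - g s = 0"
  proof (rule analytic_continuation[of "\<lambda>s. f s - g s" "half_strip \<phi> b L" U "Complex (m - 1) \<phi>"])
    show "(\<lambda>s. f s - g s) holomorphic_on half_strip \<phi> b L" by (intro holomorphic_intros f g)
    show "connected (half_strip \<phi> b L)" by (intro convex_connected convex_half_strip)
    show "U \<subseteq> half_strip \<phi> b L" "Complex (m - 1) \<phi> \<in> half_strip \<phi> b L"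
      using \<open>b > 0\<close> by (auto simp: U_def half_strip_def m_def)
    show "Complex (m - 1) \<phi> islimpt U"
      unfolding islimpt_approachable
    proof (intro allI impI)
      fix e :: real assume "e > 0"
      have "Complex (m - 1 - e/2) \<phi> - Complex (m - 1) \<phi> = of_real (- e/2)"
        by (simp add: complex_eq_iff)
      then have "dist (Complex (m - 1 - e/2) \<phi>) (Complex (m - 1) \<phi>) = \<bar>- e/2\<bar>"
        unfolding dist_norm by (simp only: norm_of_real)
      with \<open>e > 0\<close> show "\<exists>x'\<in>U. x' \<noteq> Complex (m - 1) \<phi> \<and> dist x' (Complex (m - 1) \<phi>) < e"
        by (intro bexI[of _ "Complex (m - 1 - e/2) \<phi>"]) (auto simp: U_def)
    qed
    show "\<And>z. z \<in> U \<Longrightarrow> f z - g z = 0" using eq by (auto simp: U_def m_def)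
  qed (use s in auto)
  then show ?thesis by simp
qed

lemma PVI_branch_exists_generic:
  fixes a \<mu> :: complex and \<sigma> \<phi> :: real
  assumes a: "a \<noteq> 0" and \<sigma>: "0 \<le> \<sigma>" "\<sigma> < 1" and generic: "\<sigma> = 0 \<Longrightarrow> a \<noteq> 1"
  shows "\<exists>r y. PVI_branch \<mu> \<phi> r y \<and> asymp_at_1 a \<sigma> \<phi> r y"
proof -
  \<comment> \<open>The largest rate that \<open>perturbed_power\<close> permits.\<close>
  define \<epsilon> where "\<epsilon> = (if \<sigma> = 0 then 1/2 else min \<sigma> (1 - \<sigma>) / 2)"
  interpret perturbed_power "2 * \<mu> - 1" a \<sigma> \<phi> \<epsilon>
    by unfold_locales (use assms in \<open>auto simp: \<epsilon>_def\<close>)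
  obtain C L where ode: "\<And>M. M \<le> L \<Longrightarrow> half_strip_ode \<phi> pi M \<epsilon> C F"
    and ne: "\<And>s v. Re s < L \<Longrightarrow> norm v \<le> 3 * exp (\<epsilon> * Re s) \<Longrightarrow> exp s \<noteq> 1 \<and> W s v \<noteq> 1 \<and> W s v \<noteq> exp s"
    by (rule F_half_strip_ode[OF pi_gt_zero]) (rule that, assumption+)
  \<comment> \<open>This makes \<open>norm (v s) \<le> 1/2\<close>, so that
    \<open>exp v - 1\<close>, the relative error in the asymptotics, is at most twice
    \<open>v\<close>. The 0 in \<open>M\<close> below ensures radius
    \<open>exp M \<le> 1\<close>.\<close>
  have "eventually (\<lambda>x. 1 * exp (\<epsilon> * x) \<le> 1/2) at_bot" using eps by (intro eventually_exp_le) auto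
  then obtain L0 where L0: "\<And>x. x \<le> L0 \<Longrightarrow> exp (\<epsilon> * x) \<le> 1/2"
    unfolding eventually_at_bot_linorder by auto
  define M where "M = min (min L L0) 0"
  interpret half_strip_ode \<phi> pi M \<epsilon> C F by (rule ode) (simp add: M_def)
  obtain v u where sol:
    "\<And>s. s \<in> S \<Longrightarrow> (v has_field_derivative u s) (at s)"
    "\<And>s. s \<in> S \<Longrightarrow> (u has_field_derivative F s (v s) (u s)) (at s)"
    "\<And>s. s \<in> S \<Longrightarrow> norm (v s) \<le> exp (\<epsilon> * Re s)"
    "\<And>s. s \<in> S \<Longrightarrow> norm (u s) \<le> exp (\<epsilon> * Re s)"
    by (rule solution_exists) (rule that, assumption+)
  define y where "y x = 1 - a * exp (of_real (1 - \<sigma>) * cut_log \<phi> x + v (cut_log \<phi> x))" for x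
  have "log_ode (2 * \<mu> - 1) (exp s) (a * exp (of_real (1 - \<sigma>) * s + v s)) (of_real (1 - \<sigma>) + u s) (F s (v s) (u s))"
    if s: "s \<in> S" for s
  proof -
    have "exp s \<noteq> 1 \<and> W s (v s) \<noteq> 1 \<and> W s (v s) \<noteq> exp s"
    proof (rule ne)
      show "Re s < L" using s by (simp add: half_strip_def M_def)
      show "norm (v s) \<le> 3 * exp (\<epsilon> * Re s)"
        using sol(3)[OF s] exp_gt_zero[of "\<epsilon> * Re s"] by linarith
    qed
    then show ?thesis unfolding F_def W_def by (subst log_ode_iff) auto
  qed
  with sol(1,2) a have "PVI_branch \<mu> \<phi> (exp M) y"
    unfolding y_def[abs_def]
    by (intro PVI_branch_of_log_solution[where u = u and v = v and c = "of_real (1 - \<sigma>)"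
          and u' = "\<lambda>s. F s (v s) (u s)" and M = M and \<mu> = \<mu>]) (simp_all add: M_def)
  moreover have "asymp_at_1 a \<sigma> \<phi> (exp M) y"
    unfolding asymp_at_1_def
  proof (intro exI[of _ \<epsilon>] exI[of _ "\<lambda>x. exp (v (cut_log \<phi> x)) - 1"] conjI ballI eps)
    have "norm (exp (v (cut_log \<phi> x)) - 1) \<le> 2 * norm (cut_power \<phi> x \<epsilon>)" if "x \<in> cut_disc \<phi> (exp M)" for x
    proof -
      have s: "cut_log \<phi> x \<in> S" using cut_log_in_half_strip[OF that] by simp
      then have "norm (v (cut_log \<phi> x)) \<le> 1/2"
        using order_trans[OF sol(3)[OF s] L0] by (simp add: half_strip_def M_def)
      then show ?thesis
        using norm_exp_minus_1_le[of "v (cut_log \<phi> x)"] sol(3)[OF s] by (simp add: norm_cut_power)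
    qed
    then show "(\<lambda>x. exp (v (cut_log \<phi> x)) - 1) \<in> O[at 1 within cut_disc \<phi> (exp M)](\<lambda>x. cut_power \<phi> x \<epsilon>)"
      by (intro bigoI[of _ 2]) (auto simp: eventually_at_filter intro: always_eventually)
    show "y x = 1 - a * cut_power \<phi> x (1 - \<sigma>) * (1 + (exp (v (cut_log \<phi> x)) - 1))" for x
      by (simp add: y_def cut_power_eq exp_add)
  qed
  ultimately show ?thesis by blast
qed

text \<open>For \<open>y = x\<close> the left side of the cleared equation vanishes, and the
  surviving terms on the right are 1, -2 and 1 times \<open>x^3 * (x - 1)^3\<close>.\<close>

lemma PVI_branch_identity:
  "PVI_branch \<mu> \<phi> 1 (\<lambda>x. x)" "asymp_at_1 1 0 \<phi> 1 (\<lambda>x. x)"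
proof -
  have "deriv (\<lambda>x::complex. x) = (\<lambda>_. 1)" by (rule ext) simp
  then show "PVI_branch \<mu> \<phi> 1 (\<lambda>x. x)"
    by (auto simp: PVI_branch_def PVI_eq_def algebra_simps power2_eq_square)
  have "cut_power \<phi> x 1 = 1 - x" if "x \<in> cut_disc \<phi> 1" for x
    using exp_cut_log[OF that] by (simp add: cut_power_eq)
  then show "asymp_at_1 1 0 \<phi> 1 (\<lambda>x. x)"
    unfolding asymp_at_1_def by (intro exI[of _ 1] conjI exI[of _ "\<lambda>_. 0"]) auto
qed

lemma eventually_eq_on_axis_generic:
  fixes v1 v2 :: "complex \<Rightarrow> complex"
  assumes a: "a \<noteq> 0" and \<sigma>: "0 \<le> \<sigma>" "\<sigma> < 1" and generic: "\<sigma> = 0 \<Longrightarrow> a \<noteq> 1"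
    and 1: "e1 > 0" "B1 \<ge> 0" "v1 holomorphic_on half_strip \<phi> pi L1"
      "\<And>s. s \<in> half_strip \<phi> pi L1 \<Longrightarrow> norm (v1 s) \<le> B1 * exp (e1 * Re s)"
      "\<And>s. s \<in> half_strip \<phi> pi L1 \<Longrightarrow> log_ode \<nu> (exp s) (a * exp (of_real (1 - \<sigma>) * s + v1 s))
         (of_real (1 - \<sigma>) + deriv v1 s) (deriv (deriv v1) s)"
    and 2: "e2 > 0" "B2 \<ge> 0" "v2 holomorphic_on half_strip \<phi> pi L2"
      "\<And>s. s \<in> half_strip \<phi> pi L2 \<Longrightarrow> norm (v2 s) \<le> B2 * exp (e2 * Re s)"
      "\<And>s. s \<in> half_strip \<phi> pi L2 \<Longrightarrow> log_ode \<nu> (exp s) (a * exp (of_real (1 - \<sigma>) * s + v2 s))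
         (of_real (1 - \<sigma>) + deriv v2 s) (deriv (deriv v2) s)"
  obtains M where "\<And>x. x < M \<Longrightarrow> v1 (Complex x \<phi>) = v2 (Complex x \<phi>)"
proof -
  \<comment> \<open>Also strictly below both given decay rates, as \<open>axis_bounds\<close>
    requires; \<open>perturbed_power\<close> only limits the rate from above.\<close>
  define \<epsilon> where "\<epsilon> = min (if \<sigma> = 0 then 1/2 else min \<sigma> (1 - \<sigma>) / 2) (min e1 e2 / 2)"
  interpret perturbed_power \<nu> a \<sigma> \<phi> \<epsilon>
    by unfold_locales (use a \<sigma> generic 1(1) 2(1) in \<open>auto simp: \<epsilon>_def min_def\<close>)
  have less: "\<epsilon> < e1" "\<epsilon> < e2" using 1(1) 2(1) by (auto simp: \<epsilon>_def min_def)
  obtain M1 where M1: "M1 \<le> L1" "\<And>x. x < M1 \<Longrightarrow> norm (v1 (Complex x \<phi>)) \<le> exp (\<epsilon> * x)"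
    "\<And>x. x < M1 \<Longrightarrow> norm (deriv v1 (Complex x \<phi>)) \<le> exp (\<epsilon> * x)"
    using axis_bounds[OF 1(3,2,4) eps(1) less(1)] by blast
  obtain M2 where M2: "M2 \<le> L2" "\<And>x. x < M2 \<Longrightarrow> norm (v2 (Complex x \<phi>)) \<le> exp (\<epsilon> * x)"
    "\<And>x. x < M2 \<Longrightarrow> norm (deriv v2 (Complex x \<phi>)) \<le> exp (\<epsilon> * x)"
    using axis_bounds[OF 2(3,2,4) eps(1) less(2)] by blast
  obtain C L where ode: "\<And>M. M \<le> L \<Longrightarrow> half_strip_ode \<phi> pi M \<epsilon> C F"
    and ne: "\<And>s v. Re s < L \<Longrightarrow> norm v \<le> 3 * exp (\<epsilon> * Re s) \<Longrightarrow> exp s \<noteq> 1 \<and> W s v \<noteq> 1 \<and> W s v \<noteq> exp s"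
    by (rule F_half_strip_ode[OF pi_gt_zero]) (rule that, assumption+)
  define M where "M = min L (min M1 M2)"
  interpret half_strip_ode \<phi> pi L \<epsilon> C F by (rule ode) simp
  have F: "deriv (deriv v) (Complex x \<phi>) = F (Complex x \<phi>) (v (Complex x \<phi>)) (deriv v (Complex x \<phi>))"
    if "x < M" "norm (v (Complex x \<phi>)) \<le> exp (\<epsilon> * x)"
      "log_ode \<nu> (exp (Complex x \<phi>)) (a * exp (of_real (1 - \<sigma>) * Complex x \<phi> + v (Complex x \<phi>)))
         (of_real (1 - \<sigma>) + deriv v (Complex x \<phi>)) (deriv (deriv v) (Complex x \<phi>))" for v x
  proof -
    have "exp (Complex x \<phi>) \<noteq> 1 \<and> W (Complex x \<phi>) (v (Complex x \<phi>)) \<noteq> 1 \<and> W (Complex x \<phi>) (v (Complex x \<phi>)) \<noteq> exp (Complex x \<phi>)"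
    proof (rule ne)
      show "Re (Complex x \<phi>) < L" using that(1) by (simp add: M_def)
      show "norm (v (Complex x \<phi>)) \<le> 3 * exp (\<epsilon> * Re (Complex x \<phi>))"
        using that(2) exp_gt_zero[of "\<epsilon> * x"] unfolding complex.sel by linarith
    qed
    with that(3) show ?thesis unfolding F_def W_def by (subst (asm) log_ode_iff) auto
  qed
  have mem: "Complex x \<phi> \<in> half_strip \<phi> pi K" if "x < K" for x K
    using that by (simp add: half_strip_def)
  have der: "((\<lambda>x. v (Complex x \<phi>)) has_vector_derivative deriv v (Complex x \<phi>)) (at x)"
     "((\<lambda>x. deriv v (Complex x \<phi>)) has_vector_derivative deriv (deriv v) (Complex x \<phi>)) (at x)"
    if v: "v holomorphic_on half_strip \<phi> pi K" and "x < K" for v K x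
    by (rule has_vector_derivative_horizontal[OF holomorphic_derivI[OF v open_half_strip mem[OF \<open>x < K\<close>]]])
       (rule has_vector_derivative_horizontal[OF holomorphic_derivI[OF holomorphic_deriv[OF v open_half_strip]
          open_half_strip mem[OF \<open>x < K\<close>]]])
  obtain M' where "\<And>x. x < M' \<Longrightarrow> v1 (Complex x \<phi>) = v2 (Complex x \<phi>)"
  proof (rule solution_unique_on_axis[of M "\<lambda>x. v1 (Complex x \<phi>)" "\<lambda>x. deriv v1 (Complex x \<phi>)"
        "\<lambda>x. v2 (Complex x \<phi>)" "\<lambda>x. deriv v2 (Complex x \<phi>)"])
    fix x assume x: "x < M"
    then have x': "x < L1" "x < L2" "x < M1" "x < M2" using M1(1) M2(1) by (auto simp: M_def)
    show "((\<lambda>x. deriv v1 (Complex x \<phi>)) has_vector_derivative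
        F (Complex x \<phi>) (v1 (Complex x \<phi>)) (deriv v1 (Complex x \<phi>))) (at x)"
      using der(2)[OF 1(3) x'(1)] F[OF x M1(2)[OF x'(3)] 1(5)[OF mem[OF x'(1)]]] by simp
    show "((\<lambda>x. deriv v2 (Complex x \<phi>)) has_vector_derivative
        F (Complex x \<phi>) (v2 (Complex x \<phi>)) (deriv v2 (Complex x \<phi>))) (at x)"
      using der(2)[OF 2(3) x'(2)] F[OF x M2(2)[OF x'(4)] 2(5)[OF mem[OF x'(2)]]] by simp
    show "((\<lambda>x. v1 (Complex x \<phi>)) has_vector_derivative deriv v1 (Complex x \<phi>)) (at x)"
      "((\<lambda>x. v2 (Complex x \<phi>)) has_vector_derivative deriv v2 (Complex x \<phi>)) (at x)"
      by (rule der(1)[OF 1(3) x'(1)] der(1)[OF 2(3) x'(2)])+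
    show "norm (v1 (Complex x \<phi>)) \<le> exp (\<epsilon> * x)" "norm (v2 (Complex x \<phi>)) \<le> exp (\<epsilon> * x)"
      "norm (deriv v1 (Complex x \<phi>)) \<le> exp (\<epsilon> * x)" "norm (deriv v2 (Complex x \<phi>)) \<le> exp (\<epsilon> * x)"
      using M1 M2 x' by auto
  qed (auto simp: M_def)
  then show thesis by (rule that)
qed

text \<open>Where \<open>f\<close> is nonzero at one point it is nonzero nearby, so \<open>g\<close>
  vanishes on an open set and hence everywhere.\<close>

lemma holomorphic_mult_eq_0:
  assumes "f holomorphic_on S" "g holomorphic_on S" "open S" "connected S"
    and "\<And>z. z \<in> S \<Longrightarrow> f z * g z = 0"
  shows "(\<forall>z\<in>S. f z = 0) \<or> (\<forall>z\<in>S. g z = 0)"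
proof (cases "\<forall>z\<in>S. f z = 0")
  case False
  then obtain z0 where z0: "z0 \<in> S" "f z0 \<noteq> 0" by blast
  then obtain e where e: "e > 0" "\<And>w. w \<in> S \<Longrightarrow> dist z0 w < e \<Longrightarrow> f w \<noteq> 0"
    using continuous_on_avoid[OF holomorphic_on_imp_continuous_on[OF assms(1)]] by blast
  let ?U = "S \<inter> ball z0 e"
  have U: "open ?U" "z0 \<in> ?U" using z0 e \<open>open S\<close> by auto
  have "\<forall>z\<in>S. g z = 0"
  proof
    fix z assume "z \<in> S"
    show "g z = 0"
    proof (rule analytic_continuation[OF assms(2-4), of ?U z0])
      show "z0 islimpt ?U" using U interior_limit_point interior_open by metis
      show "g w = 0" if "w \<in> ?U" for w using assms(5)[of w] e(2)[of w] that by auto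
    qed (use z0 \<open>z \<in> S\<close> in auto)
  qed
  then show ?thesis ..
qed simp

section \<open>Uniqueness of the solution \<open>y = x\<close>\<close>

text \<open>With \<open>w - t = t * h\<close> and \<open>q = 1 + u\<close>, cancelling common
  factors in \<open>log_ode\<close> gives
  \<open>h * u' = (w - 1) / (2 * (t - 1)) * u^2 + \<alpha> * h^2\<close>; this is
  \<open>\<alpha>\<close>.\<close>

definition energy_coeff :: "complex \<Rightarrow> complex \<Rightarrow> complex \<Rightarrow> complex \<Rightarrow> complex" where
  "energy_coeff \<nu> t w q = (\<nu>\<^sup>2 * (w - 1) * t / (t - 1)\<^sup>2 - q\<^sup>2 * t / ((w - 1) * (t - 1))) / 2"

lemma log_ode_energy:
  assumes ode: "log_ode \<nu> t (t * (1 + h)) (1 + u) u'" and nz: "t \<noteq> 0" "t \<noteq> 1" "t * (1 + h) \<noteq> 1"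
  shows "h * ((2 * u' - 2 * energy_coeff \<nu> t (t * (1 + h)) (1 + u) * h) * (t - 1) / (t * (1 + h) - 1)) = u\<^sup>2"
proof -
  define b d q where "b = t * (1 + h) - 1" and "d = t - 1" and "q = 1 + u"
  have nz': "b \<noteq> 0" "d \<noteq> 0" using nz by (auto simp: b_def d_def)
  have th: "t * (1 + h) - t = t * h" by (simp add: algebra_simps)
  have ode': "2 * d\<^sup>2 * b * (t * h) * u' = b\<^sup>2 * t * d * u\<^sup>2 - q\<^sup>2 * (t * h)\<^sup>2 * d + \<nu>\<^sup>2 * b\<^sup>2 * (t * h)\<^sup>2"
    using ode unfolding log_ode_def th b_def[symmetric] d_def[symmetric] q_def[symmetric]
    by (simp add: q_def)
  have c: "2 * energy_coeff \<nu> t (t * (1 + h)) (1 + u) = \<nu>\<^sup>2 * b * t / d\<^sup>2 - q\<^sup>2 * t / (b * d)"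
  proof -
    have "2 * (X / 2) = X" for X :: complex by simp
    then show ?thesis unfolding energy_coeff_def b_def d_def q_def .
  qed
  \<comment> \<open>Multiplication by this nonzero factor clears the denominators without dividing
    by \<open>h\<close>, which may vanish.\<close>
  have "(b\<^sup>2 * t * d) * (h * ((2 * u' - (\<nu>\<^sup>2 * b * t / d\<^sup>2 - q\<^sup>2 * t / (b * d)) * h) * d / b)) =
      2 * d\<^sup>2 * b * (t * h) * u' + q\<^sup>2 * (t * h)\<^sup>2 * d - \<nu>\<^sup>2 * b\<^sup>2 * (t * h)\<^sup>2"
    using nz' by (simp add: field_simps power2_eq_square)
  also have "\<dots> = (b\<^sup>2 * t * d) * u\<^sup>2" unfolding ode' by (simp add: algebra_simps)
  finally show ?thesis
    unfolding c b_def[symmetric] d_def[symmetric]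
    by (rule mult_left_cancel[THEN iffD1, rotated]) (use nz' nz in simp)
qed

text \<open>
  At \<open>a = 1\<close>, \<open>\<sigma> = 0\<close> the equation for \<open>h = exp v - 1\<close> is singular at \<open>h = 0\<close>, where it reads
  \<open>h u' = u\<^sup>2 / 2 + \<dots>\<close>. The first integral \<open>E = u\<^sup>2 / h\<close> of the leading part extends
  holomorphically through the zeros of \<open>h\<close>, because it is an affine function of \<open>u'\<close>, and
  \<open>(v, u, E)\<close> satisfies a regular linear system.
\<close>
lemma eventually_zero_on_axis_degenerate:
  assumes e: "e > 0" and B: "B \<ge> 0" and hol: "v holomorphic_on half_strip \<phi> pi L"
    and bd: "\<And>s. s \<in> half_strip \<phi> pi L \<Longrightarrow> norm (v s) \<le> B * exp (e * Re s)"
    and ode: "\<And>s. s \<in> half_strip \<phi> pi L \<Longrightarrow> log_ode \<nu> (exp s) (exp (s + v s)) (1 + deriv v s) (deriv (deriv v) s)"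
  obtains M where "\<And>x. x < M \<Longrightarrow> v (Complex x \<phi>) = 0"
proof -
  \<comment> \<open>The rate is capped at 1 because \<open>energy_coeff\<close> decays only like
    \<open>exp (Re s)\<close>.\<close>
  define e1 where "e1 = min e 1"
  have e1: "0 < e1" "e1 \<le> 1" "e1 \<le> e" using e by (auto simp: e1_def)
  \<comment> \<open>The two factors \<open>exp e1\<close> come from two Cauchy estimates, for
    \<open>v'\<close> and \<open>v''\<close>. \<open>D\<close> is half of
    \<open>6 * (norm \<nu>)^2 + 16\<close>, the bound for the two terms of \<open>\<alpha>\<close>;
    \<open>A\<close> and \<open>B'\<close> collect coefficients with some slack.\<close>
  define K where "K = B * exp e1 * exp e1"
  define D where "D = 3 * (norm \<nu>)\<^sup>2 + 8"
  define A where "A = 3 + 2 * D + 2 * K"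
  define B' where "B' = 6 * K + 2 * D"
  have K: "K \<ge> 0" using B by (simp add: K_def)
  have D: "D \<ge> 0" by (simp add: D_def)
  have "eventually (\<lambda>x. K * exp (e1 * x) \<le> 1/8 \<and> 1 * exp (1 * x) \<le> 1/4) at_bot"
    using e1 by (intro eventually_conj eventually_exp_le) auto
  then obtain L0 where L0: "\<And>x. x \<le> L0 \<Longrightarrow> K * exp (e1 * x) \<le> 1/8" "\<And>x. x \<le> L0 \<Longrightarrow> exp x \<le> 1/4"
    unfolding eventually_at_bot_linorder by auto
  \<comment> \<open>Two derivatives cost two unit margins, on the right end and in the half-width;
    the remaining half-width \<open>pi - 2\<close> still contains the axis.\<close>
  define N where "N = min (L - 2) (min L0 (-2))"
  define S where "S = half_strip \<phi> (pi - 2) N"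
  have SL: "S \<subseteq> half_strip \<phi> pi L" unfolding S_def by (intro half_strip_mono) (auto simp: N_def)
  have So: "open S" and Sc: "connected S" by (auto simp: S_def intro: convex_connected)
  have holS: "v holomorphic_on S" "deriv v holomorphic_on S" "deriv (deriv v) holomorphic_on S"
    using holomorphic_on_subset[OF hol SL] holomorphic_deriv[OF _ So] by blast+
  have K3: "norm (v s) \<le> K * exp (e1 * Re s)" "norm (deriv v s) \<le> K * exp (e1 * Re s)"
     "norm (deriv (deriv v) s) \<le> K * exp (e1 * Re s)" if "s \<in> S" for s
  proof -
    define L1 where "L1 = min L 0"
    have hol1: "v holomorphic_on half_strip \<phi> pi L1"
      by (rule holomorphic_on_subset[OF hol half_strip_mono]) (auto simp: L1_def)
    have hol2: "deriv v holomorphic_on half_strip \<phi> (pi - 1) (L1 - 1)"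
      by (rule holomorphic_on_subset[OF holomorphic_deriv[OF hol1 open_half_strip] half_strip_mono]) auto
    have bd1: "norm (v s) \<le> B * exp (e1 * Re s)" if "s \<in> half_strip \<phi> pi L1" for s
    proof -
      have "norm (v s) \<le> B * exp (e * Re s)"
        using that by (intro bd) (auto simp: half_strip_def L1_def)
      also have "\<dots> \<le> B * exp (e1 * Re s)"
        using that e1 B by (intro mult_left_mono) (auto simp: half_strip_def L1_def mult_right_mono_neg)
      finally show ?thesis .
    qed
    have bd2: "norm (deriv v s) \<le> B * exp e1 * exp (e1 * Re s)" if "s \<in> half_strip \<phi> (pi - 1) (L1 - 1)" for s
      by (rule deriv_bound_half_strip[OF hol1 B less_imp_le[OF e1(1)]], erule bd1, rule that)
    have B1: "B * exp e1 \<ge> 0" using B by simp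
    have bd3: "norm (deriv (deriv v) s) \<le> B * exp e1 * exp e1 * exp (e1 * Re s)"
      if "s \<in> half_strip \<phi> (pi - 1 - 1) (L1 - 1 - 1)" for s
      by (rule deriv_bound_half_strip[OF hol2 B1 less_imp_le[OF e1(1)]], erule bd2, rule that)
    have s: "s \<in> half_strip \<phi> (pi - 1 - 1) (L1 - 1 - 1)" "s \<in> half_strip \<phi> (pi - 1) (L1 - 1)" "s \<in> half_strip \<phi> pi L1"
      using that by (auto simp: S_def half_strip_def N_def L1_def)
    have ge: "B \<le> K" "B * exp e1 \<le> K"
      using B e1 mult_mono[of 1 "exp e1" 1 "exp e1"] unfolding K_def
      by (auto simp: mult.assoc mult_le_cancel_left1 mult_le_cancel_left)
    show "norm (v s) \<le> K * exp (e1 * Re s)"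
      using bd1[OF s(3)] mult_right_mono[OF ge(1) exp_ge_zero] by (rule order_trans)
    show "norm (deriv v s) \<le> K * exp (e1 * Re s)"
      using bd2[OF s(2)] mult_right_mono[OF ge(2) exp_ge_zero] by (rule order_trans)
    show "norm (deriv (deriv v) s) \<le> K * exp (e1 * Re s)"
      using bd3[OF s(1)] by (simp add: K_def)
  qed
  define h where "h s = exp (v s) - 1" for s
  define w where "w s = exp s * (1 + h s)" for s
  define q where "q s = 1 + deriv v s" for s
  define \<alpha> where "\<alpha> s = energy_coeff \<nu> (exp s) (w s) (q s)" for s
  define E where "E s = (2 * deriv (deriv v) s - 2 * \<alpha> s * h s) * (exp s - 1) / (w s - 1)" for s
  have est: "norm (v s) \<le> 1/8" "norm (deriv v s) \<le> 1/8" "norm (h s) \<le> 2 * norm (v s)" "norm (h s) \<le> 1/4"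
    "1/2 \<le> norm (exp s - 1)" "norm (exp s - 1) \<le> 5/4" "1/2 \<le> norm (w s - 1)" "norm (w s - 1) \<le> 3/2"
    "norm (\<alpha> s) \<le> D * exp (e1 * Re s)" if s: "s \<in> S" for s
  proof -
    have x: "Re s \<le> L0" "Re s < 0" using s by (auto simp: S_def half_strip_def N_def)
    show v: "norm (v s) \<le> 1/8" "norm (deriv v s) \<le> 1/8"
      using K3[OF s] L0(1)[OF x(1)] by linarith+
    show h: "norm (h s) \<le> 2 * norm (v s)" unfolding h_def using v by (intro norm_exp_minus_1_le) auto
    then show h4: "norm (h s) \<le> 1/4" using v by linarith
    have t: "norm (exp s) \<le> 1/4" using L0(2)[OF x(1)] by simp
    show t1: "1/2 \<le> norm (exp s - 1)" "norm (exp s - 1) \<le> 5/4"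
      using t norm_triangle_ineq2[of 1 "exp s"] norm_triangle_ineq4[of "exp s" 1]
      by (auto simp: norm_minus_commute)
    have "norm (w s) \<le> 1/4 * (5/4)"
      unfolding w_def norm_mult using t h4 norm_triangle_ineq[of 1 "h s"] by (intro mult_mono) auto
    then show w1: "1/2 \<le> norm (w s - 1)" "norm (w s - 1) \<le> 3/2"
      using norm_triangle_ineq2[of 1 "w s"] norm_triangle_ineq4[of "w s" 1]
      by (auto simp: norm_minus_commute)
    have q: "norm (q s) \<le> 2" using v norm_triangle_ineq[of 1 "deriv v s"] by (simp add: q_def)
    have "norm (\<nu>\<^sup>2 * (w s - 1) * exp s / (exp s - 1)\<^sup>2) = (norm \<nu>)\<^sup>2 * norm (w s - 1) * exp (Re s) / (norm (exp s - 1))\<^sup>2"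
      by (simp add: norm_divide norm_mult norm_power)
    also have "\<dots> \<le> (norm \<nu>)\<^sup>2 * (3/2) * exp (Re s) / (1/2)\<^sup>2"
      using t1 w1 by (intro frac_le mult_mono power_mono mult_nonneg_nonneg) auto
    finally have 1: "norm (\<nu>\<^sup>2 * (w s - 1) * exp s / (exp s - 1)\<^sup>2) \<le> 6 * (norm \<nu>)\<^sup>2 * exp (Re s)"
      by (simp add: power2_eq_square)
    have "norm ((q s)\<^sup>2 * exp s / ((w s - 1) * (exp s - 1))) = (norm (q s))\<^sup>2 * exp (Re s) / (norm (w s - 1) * norm (exp s - 1))"
      by (simp add: norm_divide norm_mult norm_power)
    also have "\<dots> \<le> 2\<^sup>2 * exp (Re s) / ((1/2) * (1/2))"
      using t1 w1 q by (intro frac_le mult_mono power_mono mult_nonneg_nonneg) auto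
    finally have 2: "norm ((q s)\<^sup>2 * exp s / ((w s - 1) * (exp s - 1))) \<le> 16 * exp (Re s)" by simp
    have "norm (\<alpha> s) \<le> (6 * (norm \<nu>)\<^sup>2 * exp (Re s) + 16 * exp (Re s)) / 2"
      unfolding \<alpha>_def energy_coeff_def norm_divide
      using order_trans[OF norm_triangle_ineq4 add_mono[OF 1 2]] by simp
    also have "\<dots> = D * exp (Re s)" by (simp add: D_def algebra_simps)
    also have "\<dots> \<le> D * exp (e1 * Re s)" using x e1 D by (intro mult_left_mono) auto
    finally show "norm (\<alpha> s) \<le> D * exp (e1 * Re s)" .
  qed
  have nz: "exp s \<noteq> 1" "w s \<noteq> 1" if "s \<in> S" for s using est(5,7)[OF that] by auto
  have Eh: "h s * E s = (deriv v s)\<^sup>2" if s: "s \<in> S" for s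
    unfolding E_def \<alpha>_def w_def q_def
  proof (rule log_ode_energy)
    show "log_ode \<nu> (exp s) (exp s * (1 + h s)) (1 + deriv v s) (deriv (deriv v) s)"
      using ode SL s by (auto simp: h_def exp_add)
  qed (use nz[OF s] in \<open>auto simp: w_def\<close>)
  have hholS: "h holomorphic_on S" unfolding h_def[abs_def] by (intro holomorphic_intros holS)
  have wholS: "w holomorphic_on S" unfolding w_def[abs_def] by (intro holomorphic_intros hholS)
  have qholS: "q holomorphic_on S" unfolding q_def[abs_def] by (intro holomorphic_intros holS)
  have \<alpha>holS: "\<alpha> holomorphic_on S"
    unfolding \<alpha>_def[abs_def] energy_coeff_def
    by (intro holomorphic_intros wholS qholS) (use nz in auto)
  have EholS: "E holomorphic_on S"
    unfolding E_def[abs_def] by (intro holomorphic_intros wholS hholS \<alpha>holS holS) (use nz in auto)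
  \<comment> \<open>The value that differentiating \<open>h * E = v'^2\<close> forces on the
    derivative of \<open>E\<close> wherever \<open>h\<close> is nonzero.\<close>
  define G where "G s = deriv v s * (E s / (exp s - 1) + 2 * \<alpha> s)" for s
  have "h s * (deriv E s - G s) = 0" if s: "s \<in> S" for s
  proof -
    have dh: "(h has_field_derivative exp (v s) * deriv v s) (at s)"
      unfolding h_def using holomorphic_derivI[OF holS(1) So s]
      by (auto intro!: derivative_eq_intros)
    have "((\<lambda>s. h s * E s) has_field_derivative exp (v s) * deriv v s * E s + deriv E s * h s) (at s)"
      by (rule DERIV_mult[OF dh holomorphic_derivI[OF EholS So s]])
    then have "((\<lambda>s. (deriv v s)\<^sup>2) has_field_derivative exp (v s) * deriv v s * E s + deriv E s * h s) (at s)"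
      by (rule has_field_derivative_transform_within_open[OF _ So s Eh])
    moreover have "((\<lambda>s. (deriv v s)\<^sup>2) has_field_derivative 2 * deriv v s * deriv (deriv v) s) (at s)"
      using holomorphic_derivI[OF holS(2) So s] by (auto intro!: derivative_eq_intros)
    ultimately have 1: "(1 + h s) * deriv v s * E s + deriv E s * h s = 2 * deriv v s * deriv (deriv v) s"
      using DERIV_unique by (fastforce simp: h_def)
    have d0: "exp s - 1 \<noteq> 0" and w0: "w s - 1 \<noteq> 0" using nz[OF s] by auto
    have 2: "2 * deriv (deriv v) s = E s * (w s - 1) / (exp s - 1) + 2 * \<alpha> s * h s"
      unfolding E_def using d0 w0 by simp
    \<comment> \<open>The part \<open>1 + h\<close> cancels the term \<open>(1 + h) * v' * E\<close>
      produced by the product rule; everything left is a multiple of \<open>h\<close>.\<close>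
    have 3: "(w s - 1) / (exp s - 1) = 1 + h s + h s / (exp s - 1)"
      using d0 by (simp add: w_def field_simps)
    have "(1 + h s) * deriv v s * E s + deriv E s * h s =
        deriv v s * (E s * ((w s - 1) / (exp s - 1)) + 2 * \<alpha> s * h s)"
      unfolding 1 using 2 by (simp add: mult_ac)
    then show ?thesis unfolding 3 G_def by (simp add: algebra_simps)
  qed
  \<comment> \<open>Unless \<open>h\<close> vanishes identically, holomorphy extends
    \<open>E' = G\<close> across the zeros of \<open>h\<close>.\<close>
  then have alt: "(\<forall>s\<in>S. h s = 0) \<or> (\<forall>s\<in>S. deriv E s - G s = 0)"
    using nz unfolding G_def[abs_def]
    by (intro holomorphic_mult_eq_0 holomorphic_intros hholS EholS \<alpha>holS holS holomorphic_deriv So Sc) auto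
  have axis: "Complex x \<phi> \<in> S" if "x < N" for x
    using that pi_gt3 by (simp add: S_def half_strip_def)
  show thesis
  proof (cases "\<forall>s\<in>S. h s = 0")
    case True
    have "v s = 0" if s: "s \<in> S" for s
    proof -
      have "\<bar>Im (v s)\<bar> < pi" using est(1)[OF s] abs_Im_le_cmod[of "v s"] pi_gt3 by linarith
      then have "Ln (exp (v s)) = v s" by (intro Ln_exp) auto
      moreover have "exp (v s) = 1" using True s by (simp add: h_def)
      ultimately show ?thesis by simp
    qed
    then show thesis using axis by (intro that[of N]) auto
  next
    case False
    then have dE: "deriv E s = G s" if "s \<in> S" for s using alt that by auto
    obtain M where "\<And>x. x < M \<Longrightarrow> v (Complex x \<phi>) = 0"
    \<comment> \<open>The roles are \<open>f = v\<close>, \<open>g = v'\<close>,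
      \<open>k = E\<close>. The coefficient of \<open>E\<close> in \<open>v''\<close> tends to
      \<open>1/2\<close> and does not decay, which is why the system admits the term
      \<open>A * norm (k x)\<close>.\<close>
    proof (rule decaying_system_trivial[of N "\<lambda>x. v (Complex x \<phi>)" "\<lambda>x. deriv v (Complex x \<phi>)"
          "\<lambda>x. deriv v (Complex x \<phi>)" "\<lambda>x. deriv (deriv v) (Complex x \<phi>)"
          "\<lambda>x. E (Complex x \<phi>)" "\<lambda>x. G (Complex x \<phi>)" A e1 "max K B'"])
      fix x assume "x < N"
      define s where "s = Complex x \<phi>"
      define X where "X = exp (e1 * x)"
      have s: "s \<in> S" using axis[OF \<open>x < N\<close>] by (simp add: s_def)
      have Res: "Re s = x" by (simp add: s_def)
      note est = est[OF s, unfolded Res, folded X_def] and K3 = K3[OF s, unfolded Res, folded X_def]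
      have X: "X > 0" by (simp add: X_def)
      have A: "A \<ge> 1" "A \<ge> 3" "A \<ge> 2 * D" "A \<ge> 2 * K" using K D by (auto simp: A_def)
      show "((\<lambda>x. v (Complex x \<phi>)) has_vector_derivative deriv v (Complex x \<phi>)) (at x)"
        "((\<lambda>x. deriv v (Complex x \<phi>)) has_vector_derivative deriv (deriv v) (Complex x \<phi>)) (at x)"
        using holomorphic_derivI[OF holS(1) So s] holomorphic_derivI[OF holS(2) So s]
        unfolding s_def by (auto intro: has_vector_derivative_horizontal)
      show "((\<lambda>x. E (Complex x \<phi>)) has_vector_derivative G (Complex x \<phi>)) (at x)"
        using holomorphic_derivI[OF EholS So s] unfolding dE[OF s]
        unfolding s_def by (rule has_vector_derivative_horizontal)
      have "norm (deriv v s) \<le> A * norm (deriv v s)"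
        using mult_right_mono[OF A(1), of "norm (deriv v s)"] by simp
      then show "norm (deriv v (Complex x \<phi>)) \<le> A * norm (deriv v (Complex x \<phi>))" by (simp add: s_def)
      have "norm (deriv (deriv v) s) \<le> A * norm (E s) + A * X * (norm (v s) + norm (deriv v s))"
      proof -
        have "deriv (deriv v) s = E s * (w s - 1) / (exp s - 1) / 2 + \<alpha> s * h s"
          unfolding E_def using nz[OF s] by (simp add: diff_divide_distrib)
        then have "norm (deriv (deriv v) s) \<le> norm (E s * (w s - 1) / (exp s - 1) / 2) + norm (\<alpha> s * h s)"
          by (metis norm_triangle_ineq)
        also have "norm (E s * (w s - 1) / (exp s - 1) / 2) = norm (E s) * norm (w s - 1) / norm (exp s - 1) / 2"
          by (simp only: norm_mult norm_divide norm_numeral)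
        also have "\<dots> \<le> norm (E s) * (3/2) / (1/2) / 2"
          using est by (intro divide_right_mono frac_le mult_left_mono) auto
        also have "norm (\<alpha> s * h s) \<le> (D * X) * (2 * norm (v s))"
          unfolding norm_mult using est D X by (intro mult_mono) auto
        finally have "norm (deriv (deriv v) s) \<le> 3/2 * norm (E s) + (2 * D) * (X * norm (v s))" by simp
        also have "\<dots> \<le> A * norm (E s) + A * (X * norm (v s))"
          using A X by (intro add_mono mult_right_mono) auto
        also have "\<dots> \<le> A * norm (E s) + A * X * (norm (v s) + norm (deriv v s))"
          using A X by (simp add: distrib_left)
        finally show ?thesis .
      qed
      then show "norm (deriv (deriv v) (Complex x \<phi>)) \<le> A * norm (E (Complex x \<phi>)) +
          A * exp (e1 * x) * (norm (v (Complex x \<phi>)) + norm (deriv v (Complex x \<phi>)))"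
        by (simp add: s_def X_def)
      have "norm (G s) \<le> A * X * (norm (v s) + norm (deriv v s) + norm (E s))"
      proof -
        have "norm (G s) \<le> norm (deriv v s) * (norm (E s / (exp s - 1)) + norm (2 * \<alpha> s))"
          unfolding G_def norm_mult[of "deriv v s"] by (intro mult_left_mono norm_triangle_ineq norm_ge_zero)
        also have "\<dots> \<le> norm (deriv v s) * (norm (E s) / (1/2) + 2 * (D * X))"
        proof (intro mult_left_mono add_mono norm_ge_zero)
          show "norm (E s / (exp s - 1)) \<le> norm (E s) / (1/2)"
            unfolding norm_divide using est by (intro divide_left_mono) auto
          show "norm (2 * \<alpha> s) \<le> 2 * (D * X)" using est by (simp add: norm_mult)
        qed
        also have "\<dots> = norm (deriv v s) * (2 * norm (E s)) + (2 * D) * (X * norm (deriv v s))"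
          by (simp add: algebra_simps)
        also have "\<dots> \<le> (K * X) * (2 * norm (E s)) + (2 * D) * (X * norm (deriv v s))"
          using K3 by (intro add_right_mono mult_right_mono) auto
        also have "\<dots> = (2 * K) * (X * norm (E s)) + (2 * D) * (X * norm (deriv v s))" by simp
        also have "\<dots> \<le> A * (X * norm (E s)) + A * (X * norm (deriv v s))"
          using A X by (intro add_mono mult_right_mono) auto
        also have "\<dots> \<le> A * X * (norm (v s) + norm (deriv v s) + norm (E s))"
          using A X by (simp add: distrib_left)
        finally show ?thesis .
      qed
      then show "norm (G (Complex x \<phi>)) \<le> A * exp (e1 * x) *
          (norm (v (Complex x \<phi>)) + norm (deriv v (Complex x \<phi>)) + norm (E (Complex x \<phi>)))"
        by (simp add: s_def X_def)
      have "norm (E s) \<le> B' * X"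
      proof -
        have "norm (2 * deriv (deriv v) s - 2 * \<alpha> s * h s) \<le> 2 * norm (deriv (deriv v) s) + 2 * (norm (\<alpha> s) * norm (h s))"
          using norm_triangle_ineq4[of "2 * deriv (deriv v) s" "2 * \<alpha> s * h s"] by (simp add: norm_mult)
        also have "\<dots> \<le> 2 * (K * X) + 2 * ((D * X) * (1/4))"
          using K3 est D X by (intro add_mono mult_left_mono mult_mono) auto
        finally have 1: "norm (2 * deriv (deriv v) s - 2 * \<alpha> s * h s) \<le> 2 * (K * X) + D * X / 2" by simp
        have "norm (E s) = norm (2 * deriv (deriv v) s - 2 * \<alpha> s * h s) * norm (exp s - 1) / norm (w s - 1)"
          by (simp only: E_def norm_divide norm_mult)
        also have "\<dots> \<le> (2 * (K * X) + D * X / 2) * (5/4) / (1/2)"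
          using 1 est K D X by (intro frac_le mult_mono) auto
        also have "\<dots> \<le> B' * X" using K D X by (simp add: B'_def distrib_right)
        finally show ?thesis .
      qed
      also have "\<dots> \<le> max K B' * X" using X by (intro mult_right_mono) auto
      finally show "norm (E (Complex x \<phi>)) \<le> max K B' * exp (e1 * x)" by (simp add: s_def X_def)
      have KX: "K * X \<le> max K B' * X" using X by (intro mult_right_mono) auto
      show "norm (v (Complex x \<phi>)) \<le> max K B' * exp (e1 * x)"
        "norm (deriv v (Complex x \<phi>)) \<le> max K B' * exp (e1 * x)"
        using order_trans[OF K3(1) KX] order_trans[OF K3(2) KX] by (simp_all add: s_def X_def)
    qed (use e1 K D in \<open>auto simp: A_def\<close>)
    then show thesis by (rule that)
  qed
qed

section \<open>Uniqueness on the common domain, and conclusion\<close>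

lemma PVI_branch_unique:
  fixes a \<mu> :: complex and \<sigma> \<phi> :: real
  assumes a: "a \<noteq> 0" and \<sigma>: "0 \<le> \<sigma>" "\<sigma> < 1"
    and y: "PVI_branch \<mu> \<phi> r y" "asymp_at_1 a \<sigma> \<phi> r y"
    and z: "PVI_branch \<mu> \<phi> s z" "asymp_at_1 a \<sigma> \<phi> s z"
    and x: "x \<in> cut_disc \<phi> r \<inter> cut_disc \<phi> s"
  shows "y x = z x"
proof -
  obtain e1 B1 L1 v1 where 1: "e1 > 0" "B1 \<ge> 0" "L1 \<le> ln r" "v1 holomorphic_on half_strip \<phi> pi L1"
    "\<And>s. s \<in> half_strip \<phi> pi L1 \<Longrightarrow> norm (v1 s) \<le> B1 * exp (e1 * Re s)"
    "\<And>s. s \<in> half_strip \<phi> pi L1 \<Longrightarrow> y (1 - exp s) = 1 - a * exp (of_real (1 - \<sigma>) * s + v1 s)"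
    "\<And>s. s \<in> half_strip \<phi> pi L1 \<Longrightarrow> log_ode (2 * \<mu> - 1) (exp s) (a * exp (of_real (1 - \<sigma>) * s + v1 s))
       (of_real (1 - \<sigma>) + deriv v1 s) (deriv (deriv v1) s)"
    using log_solution_of_PVI_branch[OF y a] by blast
  obtain e2 B2 L2 v2 where 2: "e2 > 0" "B2 \<ge> 0" "L2 \<le> ln s" "v2 holomorphic_on half_strip \<phi> pi L2"
    "\<And>s. s \<in> half_strip \<phi> pi L2 \<Longrightarrow> norm (v2 s) \<le> B2 * exp (e2 * Re s)"
    "\<And>s. s \<in> half_strip \<phi> pi L2 \<Longrightarrow> z (1 - exp s) = 1 - a * exp (of_real (1 - \<sigma>) * s + v2 s)"
    "\<And>s. s \<in> half_strip \<phi> pi L2 \<Longrightarrow> log_ode (2 * \<mu> - 1) (exp s) (a * exp (of_real (1 - \<sigma>) * s + v2 s))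
       (of_real (1 - \<sigma>) + deriv v2 s) (deriv (deriv v2) s)"
    using log_solution_of_PVI_branch[OF z a] by blast
  obtain M where M: "\<And>x. x < M \<Longrightarrow> v1 (Complex x \<phi>) = v2 (Complex x \<phi>)"
  proof (cases "\<sigma> = 0 \<and> a = 1")
    case False
    then show thesis
      using eventually_eq_on_axis_generic[OF a \<sigma> _ 1(1,2,4,5,7) 2(1,2,4,5,7)] that by blast
  next
    case True
    obtain M1 where "\<And>x. x < M1 \<Longrightarrow> v1 (Complex x \<phi>) = 0"
      using eventually_zero_on_axis_degenerate[OF 1(1,2,4,5), of "2 * \<mu> - 1"] 1(7) True by auto
    moreover obtain M2 where "\<And>x. x < M2 \<Longrightarrow> v2 (Complex x \<phi>) = 0"
      using eventually_zero_on_axis_degenerate[OF 2(1,2,4,5), of "2 * \<mu> - 1"] 2(7) True by auto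
    ultimately show thesis by (intro that[of "min M1 M2"]) auto
  qed
  have pos: "r > 0" "s > 0" using y z by (auto simp: PVI_branch_def)
  \<comment> \<open>Both discs are cut along the same ray, so their intersection is the smaller one,
    and this is its image under \<open>cut_log \<phi>\<close>. Equality on a remote part of the axis
    spreads over all of it.\<close>
  let ?S = "half_strip \<phi> pi (ln (min r s))"
  have lg: "cut_log \<phi> x \<in> ?S"
    using x cut_log_in_half_strip[of x \<phi> r] cut_log_in_half_strip[of x \<phi> s] by (auto simp: min_def)
  have sub: "1 - exp w \<in> cut_disc \<phi> r" "1 - exp w \<in> cut_disc \<phi> s" if "w \<in> ?S" for w
    using that pos half_strip_mono[of pi pi "ln (min r s)" "ln r" \<phi>] half_strip_mono[of pi pi "ln (min r s)" "ln s" \<phi>]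
    by (auto intro!: cut_disc_of_half_strip)
  have hol: "(\<lambda>w. f (1 - exp w)) holomorphic_on ?S"
    if "f holomorphic_on cut_disc \<phi> d" "\<And>w. w \<in> ?S \<Longrightarrow> 1 - exp w \<in> cut_disc \<phi> d" for f d
  proof -
    have "(\<lambda>w. 1 - exp w) holomorphic_on ?S" by (intro holomorphic_intros)
    from holomorphic_on_compose_gen[OF this that(1)] that(2) show ?thesis by (auto simp: o_def)
  qed
  have "y (1 - exp (cut_log \<phi> x)) = z (1 - exp (cut_log \<phi> x))"
  proof (rule eq_of_eq_on_axis[OF hol hol pi_gt_zero _ lg])
    show "y holomorphic_on cut_disc \<phi> r" "z holomorphic_on cut_disc \<phi> s"
      using y z by (auto simp: PVI_branch_def)
    fix t assume t: "t < min M (min L1 L2)"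
    then have "Complex t \<phi> \<in> half_strip \<phi> pi L1" "Complex t \<phi> \<in> half_strip \<phi> pi L2"
      by (auto simp: half_strip_def)
    then show "y (1 - exp (Complex t \<phi>)) = z (1 - exp (Complex t \<phi>))"
      using 1(6) 2(6) M[of t] t by simp
  qed (use sub in auto)
  then show ?thesis using exp_cut_log[of x \<phi> r] x by simp
qed

theorem theorem2p2:
  fixes \<mu> a\<^sub>1 :: complex and \<sigma>\<^sub>1 \<phi> :: real
  assumes "2 * \<mu> \<notin> \<int>" and "a\<^sub>1 \<noteq> 0" and "0 \<le> \<sigma>\<^sub>1" and "\<sigma>\<^sub>1 < 1"
  shows "(\<exists>r y. PVI_branch \<mu> \<phi> r y \<and> asymp_at_1 a\<^sub>1 \<sigma>\<^sub>1 \<phi> r y) \<and>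
    (\<forall>r y s z. PVI_branch \<mu> \<phi> r y \<and> asymp_at_1 a\<^sub>1 \<sigma>\<^sub>1 \<phi> r y \<and>
               PVI_branch \<mu> \<phi> s z \<and> asymp_at_1 a\<^sub>1 \<sigma>\<^sub>1 \<phi> s z \<longrightarrow>
       (\<forall>x\<in>cut_disc \<phi> r \<inter> cut_disc \<phi> s. y x = z x))"
proof
  show "\<exists>r y. PVI_branch \<mu> \<phi> r y \<and> asymp_at_1 a\<^sub>1 \<sigma>\<^sub>1 \<phi> r y"
  \<comment> \<open>For the excluded pair the contraction does not apply and the explicit solution
    \<open>y = x\<close> takes its place.\<close>
  proof (cases "\<sigma>\<^sub>1 = 0 \<and> a\<^sub>1 = 1")
    case True
    then show ?thesis using PVI_branch_identity by blast
  next
    case False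
    then show ?thesis using assms by (intro PVI_branch_exists_generic) auto
  qed
  show "\<forall>r y s z. PVI_branch \<mu> \<phi> r y \<and> asymp_at_1 a\<^sub>1 \<sigma>\<^sub>1 \<phi> r y \<and>
               PVI_branch \<mu> \<phi> s z \<and> asymp_at_1 a\<^sub>1 \<sigma>\<^sub>1 \<phi> s z \<longrightarrow>
       (\<forall>x\<in>cut_disc \<phi> r \<inter> cut_disc \<phi> s. y x = z x)"
    using PVI_branch_unique[OF assms(2-4)] by blast
qed

end
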